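(* Let $p\in[1,\infty)$. There exists a constant $H(\eta)>0$, depending only on $\eta$, such that the following holds. Assume: (i) for some $K\le H(\eta)$ (with $K>0$) there is a sequence of Borel maps $T_n:\Omega\to V_n$ with $T_n\#\mu=\mu_n$ and $\sup_{x\in\Omega}|T_n(x)-x|\le K\varepsilon_n$ for every $n\in\mathbb N$; (ii) $\eta$ is continuous at $0$, non-increasing, and $\eta(0)>0$; (iii) there is $D>0$ with $\frac1D\le\rho(x)\le D$ for all $x\in\Omega$. Additionally assume there exists $q>p$ such that $\aleph_\eta^q<+\infty$. Let $(u_n)_{n\in\mathbb N}$ be a sequence of functions $u_n:V_n\to\mathbb R$ such that $\{\|u_n\|_{L^p(V_n;\mu_n)}\}_{n\in\mathbb N}$ and $\{\mathcal{GE}_n^p(u_n)\}_{n\in\mathbb N}$ are bounded. Then the sequence $\big((u_n,\mu_n)\big)_{n\in\mathbb N}$ is relatively compact in $TL^p(\Omega)$.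
   Context: $\mathbb N=\{1,2,\dots\}$; $d\in\mathbb N$; $\Omega\subset\mathbb R^d$ is open and bounded with Lipschitz boundary (near each boundary point, in suitable orthonormal coordinates, $\Omega$ is the region on one side of the graph of a Lipschitz function). $\mu$ is a probability measure on $\Omega$ with continuous density $\rho:\Omega\to\mathbb R$ with respect to Lebesgue measure. For $n\in\mathbb N$, $V_n\subset\Omega$ is a finite set, $\mu_n$ is a probability measure on $V_n$ (also regarded as a measure on $\Omega$, so that functions on $V_n$ are elements of $L^p(\Omega;\mu_n)$), $\mu_n(x):=\mu_n(\{x\})$. $(\varepsilon_n)_{n\in\mathbb N}$ is a sequence of positive reals with $\varepsilon_n\to0$. The kernel is a function $\eta:[0,\infty)\to[0,\infty)$, and $\eta_\varepsilon(r):=\varepsilon^{-d}\eta(r/\varepsilon)$ for $\varepsilon>0$. For $t\ge0$, $\aleph_\eta^t:=\int_0^\infty\eta(r)r^{d+t-1}\,dr$. The push-forward is $T\#\mu(A):=\mu(T^{-1}(A))$. For $u:V_n\to\mathbb R$ and $p\ge1$, $$\|u\|_{L^p(V_n;\mu_n)}:=\Big(\sum_{x\in V_n}|u(x)|^p\mu_n(x)\Big)^{1/p},\qquad \mathcal{GE}_n^p(u):=\frac1{\varepsilon_n^p}\sum_{x\in V_n}\sum_{y\in V_n}\eta_{\varepsilon_n}(|x-y|)|u(x)-u(y)|^p\mu_n(x)\mu_n(y).$$ $TL^p(\Omega)$ is the set of pairs $(f,\nu)$ with $\nu$ a Borel probability measure on $\Omega$ with finite $p$-th moment and $f\in L^p(\Omega;\nu)$,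 with the metric $$d_{TL^p(\Omega)}\big((f,\nu),(g,\lambda)\big):=\inf_{\gamma\in\Gamma(\nu,\lambda)}\Big(\int_{\Omega\times\Omega}|x-y|^p+|f(x)-g(y)|^p\,d\gamma(x,y)\Big)^{1/p},$$ where $\Gamma(\nu,\lambda)$ is the set of couplings of $\nu$ and $\lambda$. A sequence is relatively compact if every subsequence has a further subsequence converging in $TL^p(\Omega)$. *)

theory Defs
  imports "HOL-Probability.Probability"
begin

text \<open>
  The Euclidean space is an arbitrary type of class \<open>euclidean_space\<close>, with \<open>d = DIM('a)\<close>.
  A Borel measure on \<open>\<Omega>\<close> is a measure on the trace sigma-algebra \<open>restrict_space borel \<Omega>\<close>.
\<close>

subsection \<open>Lipschitz boundary\<close>

text \<open>
  Orthonormal coordinates at a boundary point enter only through their last axis \<open>e\<close>: the other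
  coordinates of \<open>x\<close> are recorded by the projection \<open>x - (x \<bullet> e) *\<^sub>R e\<close> onto the hyperplane
  orthogonal to \<open>e\<close>, on which \<open>\<phi>\<close> is defined.
\<close>

definition lipschitz_boundary :: "'a::euclidean_space set \<Rightarrow> bool" where
  "lipschitz_boundary \<Omega> \<longleftrightarrow>
     (\<forall>x0 \<in> frontier \<Omega>. \<exists>r>0. \<exists>e L. \<exists>\<phi> :: 'a \<Rightarrow> real.
        norm e = 1 \<and> L-lipschitz_on {y. y \<bullet> e = 0} \<phi> \<and>
        \<Omega> \<inter> ball x0 r = {x \<in> ball x0 r. \<phi> (x - (x \<bullet> e) *\<^sub>R e) < x \<bullet> e})"

subsection \<open>Probability measures on \<open>\<Omega>\<close>\<close>

definition borel_prob_on :: "'a::euclidean_space set \<Rightarrow> 'a measure \<Rightarrow> bool" where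
  "borel_prob_on \<Omega> \<nu> \<longleftrightarrow> prob_space \<nu> \<and> sets \<nu> = sets (restrict_space borel \<Omega>)"

definition has_density_on :: "'a::euclidean_space set \<Rightarrow> 'a measure \<Rightarrow> ('a \<Rightarrow> real) \<Rightarrow> bool" where
  "has_density_on \<Omega> \<mu> \<rho> \<longleftrightarrow>
     (\<forall>x\<in>\<Omega>. 0 \<le> \<rho> x) \<and> \<mu> = density (restrict_space lborel \<Omega>) (\<lambda>x. ennreal (\<rho> x))"

subsection \<open>Kernel and graph functionals\<close>

definition scaled_kernel :: "nat \<Rightarrow> (real \<Rightarrow> real) \<Rightarrow> real \<Rightarrow> real \<Rightarrow> real" where
  "scaled_kernel d \<eta> \<epsilon> r = \<eta> (r / \<epsilon>) / \<epsilon> ^ d"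

definition kernel_moment :: "nat \<Rightarrow> (real \<Rightarrow> real) \<Rightarrow> real \<Rightarrow> ennreal" where
  "kernel_moment d \<eta> t =
     (\<integral>\<^sup>+r\<in>{0..}. ennreal (\<eta> r * r powr (real d + t - 1)) \<partial>lborel)"

definition graph_Lp_norm ::
    "real \<Rightarrow> 'a set \<Rightarrow> 'a measure \<Rightarrow> ('a \<Rightarrow> real) \<Rightarrow> real" where
  "graph_Lp_norm p V m u = (\<Sum>x\<in>V. \<bar>u x\<bar> powr p * measure m {x}) powr (1 / p)"

definition graph_energy ::
    "(real \<Rightarrow> real) \<Rightarrow> real \<Rightarrow> real \<Rightarrow> 'a::euclidean_space set \<Rightarrow> 'a measure \<Rightarrow> ('a \<Rightarrow> real) \<Rightarrow> real"
  where
  "graph_energy \<eta> \<epsilon> p V m u =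
     1 / \<epsilon> powr p *
     (\<Sum>x\<in>V. \<Sum>y\<in>V. scaled_kernel DIM('a) \<eta> \<epsilon> (norm (x - y)) *
        \<bar>u x - u y\<bar> powr p * measure m {x} * measure m {y})"

subsection \<open>The space \<open>TL\<^sup>p(\<Omega>)\<close>\<close>

text \<open>Functions are representatives, not almost-everywhere classes, so \<open>TLp_dist\<close> is a pseudometric.\<close>

definition TLp :: "real \<Rightarrow> 'a::euclidean_space set \<Rightarrow> (('a \<Rightarrow> real) \<times> 'a measure) set" where
  "TLp p \<Omega> = {(f, \<nu>). borel_prob_on \<Omega> \<nu> \<and> integrable \<nu> (\<lambda>x. norm x powr p) \<and>
     f \<in> borel_measurable \<nu> \<and> integrable \<nu> (\<lambda>x. \<bar>f x\<bar> powr p)}"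

definition couplings :: "'a measure \<Rightarrow> 'a measure \<Rightarrow> ('a \<times> 'a) measure set" where
  "couplings \<nu> \<kappa> = {\<gamma>. sets \<gamma> = sets (\<nu> \<Otimes>\<^sub>M \<kappa>) \<and> distr \<gamma> \<nu> fst = \<nu> \<and> distr \<gamma> \<kappa> snd = \<kappa>}"

text \<open>
  For pairs in \<open>TLp p \<Omega>\<close> with \<open>p \<ge> 1\<close> the integrand below is integrable with respect to every
  coupling, so the Bochner integral never takes its default value there.
\<close>

definition TLp_dist ::
    "real \<Rightarrow> ('a::euclidean_space \<Rightarrow> real) \<times> 'a measure \<Rightarrow> ('a \<Rightarrow> real) \<times> 'a measure \<Rightarrow> real" where
  "TLp_dist p = (\<lambda>(f, \<nu>) (g, \<kappa>). INF \<gamma>\<in>couplings \<nu> \<kappa>.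
     (\<integral>(x, y). norm (x - y) powr p + \<bar>f x - g y\<bar> powr p \<partial>\<gamma>) powr (1 / p))"

definition TLp_relatively_compact ::
    "real \<Rightarrow> 'a::euclidean_space set \<Rightarrow> (nat \<Rightarrow> ('a \<Rightarrow> real) \<times> 'a measure) \<Rightarrow> bool" where
  "TLp_relatively_compact p \<Omega> X \<longleftrightarrow> (\<forall>n. X n \<in> TLp p \<Omega>) \<and>
     (\<forall>r :: nat \<Rightarrow> nat. strict_mono r \<longrightarrow>
        (\<exists>s :: nat \<Rightarrow> nat. strict_mono s \<and>
           (\<exists>Z \<in> TLp p \<Omega>. (\<lambda>k. TLp_dist p (X (r (s k))) Z) \<longlonglongrightarrow> 0)))"

text \<open>
  The element of \<open>L\<^sup>p(\<Omega>; \<mu>\<^sub>n)\<close> given by a function on the finite set \<open>V\<close>; the values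
  outside \<open>V\<close> are irrelevant because \<open>\<mu>\<^sub>n\<close> is concentrated on \<open>V\<close>.
\<close>

definition zero_extension :: "'a set \<Rightarrow> ('a \<Rightarrow> real) \<Rightarrow> 'a \<Rightarrow> real" where
  "zero_extension V u = (\<lambda>x. if x \<in> V then u x else 0)"

end

theory Submission
  imports Defs "HOL-Complex_Analysis.Great_Picard" "HOL-Library.Diagonal_Subsequence"
begin

text \<open>
  Transport the functions on the point clouds to \<open>\<Omega>\<close> by \<open>v\<^sub>n = u\<^sub>n \<circ> T\<^sub>n\<close>.  The coupling
  \<open>(T\<^sub>n, id)#\<mu>\<close> shows that \<open>(u\<^sub>n, \<mu>\<^sub>n)\<close> is as close to \<open>(f, \<mu>)\<close> in \<open>TL\<^sup>p\<close> as \<open>v\<^sub>n\<close> is to \<open>f\<close> in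
  \<open>L\<^sup>p(\<Omega>)\<close>, up to the displacement \<open>K \<epsilon>\<^sub>n\<close> of \<open>T\<^sub>n\<close> (\<open>TLp_dist_bounds\<close>).  Since \<open>\<rho>\<close> is bounded
  above and below, \<open>L\<^sup>p(\<mu>)\<close> and \<open>L\<^sup>p\<close> of Lebesgue measure agree on \<open>\<Omega>\<close>, and it is enough to
  extract from \<open>(v\<^sub>n)\<close> a subsequence that converges in the latter.

  The bound on the graph energies enters as follows.  By continuity \<open>\<eta> \<ge> \<eta>(0)/2\<close> on some interval
  \<open>[0, 2c]\<close>; this \<open>c\<close> depends on \<open>\<eta>\<close> alone, and \<open>H = c/2\<close>.  If \<open>T\<^sub>n\<close> moves points by at most
  \<open>c \<epsilon>\<^sub>n / 2\<close>, then points at distance at most \<open>c \<epsilon>\<^sub>n\<close> are sent to points at distance at most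
  \<open>2 c \<epsilon>\<^sub>n\<close>, where the kernel is at least \<open>\<eta>(0)/2\<close>.  So the graph energy controls the double
  integral of \<open>\<bar>v\<^sub>n(x) - v\<^sub>n(y)\<bar>\<^sup>p\<close> over the pairs at distance at most \<open>c \<epsilon>\<^sub>n\<close>, which is therefore
  \<open>O(\<epsilon>\<^sub>n\<^sup>p\<^sup>+\<^sup>d)\<close> (\<open>pullback_energy_le\<close>).

  That bound at the vanishing scale \<open>\<epsilon>\<^sub>n\<close> gives a Poincare inequality at every fixed scale \<open>h\<close>.
  A segment from \<open>x\<close> to \<open>x + z\<close> with \<open>\<bar>z\<bar> \<le> 2h\<close> is cut into \<open>m\<close> steps of length at most
  \<open>c \<epsilon>\<^sub>n\<close>, with \<open>m\<close> of the order \<open>h / \<epsilon>\<^sub>n\<close>.  Convexity of \<open>\<bar>\<cdot>\<bar>\<^sup>p\<close> costs a factor \<open>m\<^sup>p\<close> over the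
  whole chain and the substitution \<open>z \<mapsto> z / m\<close> a factor \<open>m\<^sup>d\<close>, and \<open>m\<^sup>p\<^sup>+\<^sup>d \<epsilon>\<^sub>n\<^sup>p\<^sup>+\<^sup>d\<close> is of order
  \<open>h\<^sup>p\<^sup>+\<^sup>d\<close> (\<open>nonlocal_chain_estimate\<close>).  Hence \<open>v\<^sub>n\<close> differs from its average over a ball of radius
  proportional to \<open>h\<close> by \<open>O(h)\<close> in \<open>L\<^sup>p\<close>, for all large \<open>n\<close>
  (\<open>tent_average_error_small_scale\<close>).  The chains have to stay inside \<open>\<Omega>\<close>, and this is the only
  place where the regularity of the boundary matters: near each point of the closure, a Lipschitz
  domain contains the translates of one fixed truncated cone with apex at the points of the domain
  (\<open>lipschitz_boundary_interior_cone\<close>), and the average is taken over a ball inside that cone.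

  For fixed \<open>h\<close> the averages are equibounded and equi-Lipschitz, so Arzela-Ascoli applies to them.
  Finitely many cone neighbourhoods cover the compact closure of \<open>\<Omega>\<close>, and a diagonal argument over
  the tolerances produces a Cauchy subsequence, which converges by completeness of \<open>L\<^sup>p\<close>
  (\<open>Lp_convergent_subsequence\<close>).
\<close>

section \<open>Convexity of powers of the absolute value\<close>

text \<open>
  The power function is known to be convex on the open half-line.  The endpoint \<open>0\<close> is added by
  hand: there convexity says \<open>s\<^sup>p \<le> s\<close> for \<open>0 < s < 1\<close>.
\<close>

lemma convex_on_abs_powr:
  fixes p :: real
  assumes "1 \<le> p"
  shows "convex_on UNIV (\<lambda>x::real. \<bar>x\<bar> powr p)"
proof (rule convex_onI)
  fix t x y :: real
  assume t: "0 < t" "t < 1"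
  have nonneg: "((1 - t) * a + t * b) powr p \<le> (1 - t) * a powr p + t * b powr p"
    if ab: "0 \<le> a" "0 \<le> b" for a b
  proof -
    have shrink: "(s * c) powr p \<le> s * c powr p" if "0 < s" "s < 1" "0 \<le> c" for s c :: real
    proof -
      have "s powr p \<le> s powr 1"
        using that assms by (intro powr_mono') auto
      then show ?thesis
        using that by (simp add: powr_mult mult_right_mono)
    qed
    consider "a = 0" | "b = 0" | "0 < a" "0 < b" using ab by fastforce
    then show ?thesis
    proof cases
      case 1 then show ?thesis using shrink[of t b] t ab assms by simp
    next
      case 2 then show ?thesis using shrink[of "1 - t" a] t ab assms by simp
    next
      case 3
      then show ?thesis
        using convex_onD[OF powr_convex[OF assms], of t a b] t by simp
    qed
  qed
  have "\<bar>(1 - t) *\<^sub>R x + t *\<^sub>R y\<bar> \<le> (1 - t) * \<bar>x\<bar> + t * \<bar>y\<bar>"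
    using t abs_triangle_ineq[of "(1 - t) * x" "t * y"] by (simp add: abs_mult)
  then have "\<bar>(1 - t) *\<^sub>R x + t *\<^sub>R y\<bar> powr p \<le> ((1 - t) * \<bar>x\<bar> + t * \<bar>y\<bar>) powr p"
    using assms by (intro powr_mono2) auto
  also have "\<dots> \<le> (1 - t) * \<bar>x\<bar> powr p + t * \<bar>y\<bar> powr p"
    by (rule nonneg) auto
  finally show "\<bar>(1 - t) *\<^sub>R x + t *\<^sub>R y\<bar> powr p \<le> (1 - t) * \<bar>x\<bar> powr p + t * \<bar>y\<bar> powr p" .
qed auto

lemma abs_sum_powr_le:
  fixes a :: "nat \<Rightarrow> real"
  assumes "1 \<le> p" "0 < m"
  shows "\<bar>\<Sum>i<m. a i\<bar> powr p \<le> real m powr (p - 1) * (\<Sum>i<m. \<bar>a i\<bar> powr p)"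
proof -
  have "\<bar>\<Sum>i<m. (1 / real m) *\<^sub>R a i\<bar> powr p \<le> (\<Sum>i<m. (1 / real m) * \<bar>a i\<bar> powr p)"
    by (rule convex_on_sum[OF _ _ convex_on_abs_powr[OF assms(1)]]) (use assms in auto)
  moreover have "\<bar>\<Sum>i<m. a i\<bar> powr p = real m powr p * \<bar>\<Sum>i<m. (1 / real m) *\<^sub>R a i\<bar> powr p"
  proof -
    have "\<bar>\<Sum>i<m. a i\<bar> = real m * \<bar>\<Sum>i<m. (1 / real m) *\<^sub>R a i\<bar>"
      using assms by (simp flip: scaleR_sum_right sum_divide_distrib)
    then show ?thesis by (simp add: powr_mult)
  qed
  ultimately have "\<bar>\<Sum>i<m. a i\<bar> powr p \<le> real m powr p * ((1 / real m) * (\<Sum>i<m. \<bar>a i\<bar> powr p))"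
    by (simp only: sum_distrib_left[symmetric]) (intro mult_left_mono, auto)
  also have "\<dots> = real m powr (p - 1) * (\<Sum>i<m. \<bar>a i\<bar> powr p)"
    using assms by (simp add: powr_diff)
  finally show ?thesis .
qed

lemma abs_add_powr_le:
  fixes a b :: real
  assumes "1 \<le> p"
  shows "\<bar>a + b\<bar> powr p \<le> 2 powr (p - 1) * (\<bar>a\<bar> powr p + \<bar>b\<bar> powr p)"
  using abs_sum_powr_le[OF assms, of 2 "\<lambda>i. if i = 0 then a else b"]
  by (simp add: numeral_eq_Suc)

lemma abs_add3_powr_le:
  fixes a b c :: real
  assumes "1 \<le> p"
  shows "\<bar>a + b + c\<bar> powr p \<le> 3 powr (p - 1) * (\<bar>a\<bar> powr p + \<bar>b\<bar> powr p + \<bar>c\<bar> powr p)"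
  using abs_sum_powr_le[OF assms, of 3 "\<lambda>i. if i = 0 then a else if i = 1 then b else c"]
  by (simp add: numeral_eq_Suc)

lemma abs_le_one_add_abs_powr:
  fixes a :: real
  assumes "1 \<le> p"
  shows "\<bar>a\<bar> \<le> 1 + \<bar>a\<bar> powr p"
proof (cases "\<bar>a\<bar> \<le> 1")
  case False
  then have "\<bar>a\<bar> powr 1 \<le> \<bar>a\<bar> powr p" using assms by (intro powr_mono) auto
  then show ?thesis using False by simp
qed (use powr_ge_zero[of "\<bar>a\<bar>" p] in linarith)

section \<open>The nonlocal energy along chains\<close>

lemma nn_integral_lborel_affine:
  fixes f :: "'a::euclidean_space \<Rightarrow> ennreal"
  assumes [measurable]: "f \<in> borel_measurable borel" and "c \<noteq> 0"
  shows "(\<integral>\<^sup>+x. f x \<partial>lborel) = ennreal (\<bar>c\<bar> ^ DIM('a)) * (\<integral>\<^sup>+x. f (t + c *\<^sub>R x) \<partial>lborel)"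
  by (subst lborel_affine[OF assms(2), of t])
     (simp add: nn_integral_density nn_integral_distr nn_integral_cmult)

text \<open>
  The continuum counterpart of the graph energy for the kernel that is the indicator function of
  \<open>[0, r]\<close>, without normalisation in \<open>r\<close>.
\<close>

definition nonlocal_energy ::
    "real \<Rightarrow> 'a::euclidean_space set \<Rightarrow> real \<Rightarrow> ('a \<Rightarrow> real) \<Rightarrow> ennreal" where
  "nonlocal_energy p S r v =
     (\<integral>\<^sup>+x\<in>S. \<integral>\<^sup>+y\<in>S \<inter> cball x r. ennreal (\<bar>v x - v y\<bar> powr p) \<partial>lborel \<partial>lborel)"

text \<open>
  Long differences are controlled by short ones: the step from \<open>x\<close> to \<open>x + z\<close> is split into \<open>m\<close>
  equal steps, each of length at most \<open>r\<close> and with both ends in \<open>S\<close>.  By translation invariance all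
  \<open>m\<close> steps contribute at most the same amount, and rescaling \<open>z\<close> to the length of one step yields the
  Jacobian \<open>m\<^sup>d\<close>.
\<close>

lemma nonlocal_chain_estimate:
  fixes v :: "'a::euclidean_space \<Rightarrow> real"
  assumes [measurable]: "v \<in> borel_measurable borel" "S \<in> sets borel" "U \<in> sets borel" "B \<in> sets borel"
    and p: "1 \<le> p" and m: "0 < m"
    and ray: "\<And>x z t. x \<in> U \<Longrightarrow> z \<in> B \<Longrightarrow> 0 \<le> t \<Longrightarrow> t \<le> 1 \<Longrightarrow> x + t *\<^sub>R z \<in> S"
    and short: "\<And>z. z \<in> B \<Longrightarrow> norm z \<le> real m * r"
  shows "(\<integral>\<^sup>+x\<in>U. \<integral>\<^sup>+z\<in>B. ennreal (\<bar>v x - v (x + z)\<bar> powr p) \<partial>lborel \<partial>lborel)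
    \<le> ennreal (real m powr (p + DIM('a))) * nonlocal_energy p S r v"
proof -
  define g where "g x y = ennreal (\<bar>v x - v y\<bar> powr p) * (indicator S x * (indicator S y * indicator {..r} (dist x y)))"
    for x y
  have [measurable]: "(\<lambda>(x, y). g x y) \<in> borel_measurable (borel \<Otimes>\<^sub>M borel)"
    unfolding g_def by measurable
  have energy: "(\<integral>\<^sup>+x. \<integral>\<^sup>+y. g x y \<partial>lborel \<partial>lborel) = nonlocal_energy p S r v"
    unfolding nonlocal_energy_def g_def
    by (subst nn_integral_multc[symmetric], measurable)
       (auto intro!: nn_integral_cong simp: indicator_def dist_norm)
  have step: "(\<integral>\<^sup>+x. \<integral>\<^sup>+z. g (x + (i / m) *\<^sub>R z) (x + (i / m) *\<^sub>R z + (1 / m) *\<^sub>R z) \<partial>lborel \<partial>lborel)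
      = ennreal (real m ^ DIM('a)) * nonlocal_energy p S r v" for i :: real
  proof -
    have "(\<integral>\<^sup>+x. \<integral>\<^sup>+z. g (x + (i / m) *\<^sub>R z) (x + (i / m) *\<^sub>R z + (1 / m) *\<^sub>R z) \<partial>lborel \<partial>lborel)
      = (\<integral>\<^sup>+z. \<integral>\<^sup>+x. g (x + (i / m) *\<^sub>R z) (x + (i / m) *\<^sub>R z + (1 / m) *\<^sub>R z) \<partial>lborel \<partial>lborel)"
      by (subst lborel_pair.Fubini') (auto simp: split_beta')
    also have "\<dots> = (\<integral>\<^sup>+z. \<integral>\<^sup>+x. g x (x + (1 / m) *\<^sub>R z) \<partial>lborel \<partial>lborel)"
    proof (rule nn_integral_cong)
      fix z :: 'a
      show "(\<integral>\<^sup>+x. g (x + (i / m) *\<^sub>R z) (x + (i / m) *\<^sub>R z + (1 / m) *\<^sub>R z) \<partial>lborel)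
        = (\<integral>\<^sup>+x. g x (x + (1 / m) *\<^sub>R z) \<partial>lborel)"
        by (subst nn_integral_lborel_affine[of "\<lambda>x. g x (x + (1 / m) *\<^sub>R z)" 1 "(i / m) *\<^sub>R z"])
           (auto simp: add_ac)
    qed
    also have "\<dots> = (\<integral>\<^sup>+x. \<integral>\<^sup>+z. g x (x + (1 / m) *\<^sub>R z) \<partial>lborel \<partial>lborel)"
      by (subst lborel_pair.Fubini') (auto simp: split_beta')
    also have "\<dots> = (\<integral>\<^sup>+x. ennreal (real m ^ DIM('a)) * (\<integral>\<^sup>+y. g x y \<partial>lborel) \<partial>lborel)"
    proof (rule nn_integral_cong)
      fix x :: 'a
      have "ennreal (real m ^ DIM('a)) * (\<integral>\<^sup>+y. g x y \<partial>lborel)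
        = ennreal (real m ^ DIM('a)) * (ennreal (\<bar>1 / m\<bar> ^ DIM('a)) * (\<integral>\<^sup>+z. g x (x + (1 / m) *\<^sub>R z) \<partial>lborel))"
        using m by (subst nn_integral_lborel_affine[of _ "1 / m" x]) auto
      also have "\<dots> = (\<integral>\<^sup>+z. g x (x + (1 / m) *\<^sub>R z) \<partial>lborel)"
        using m by (simp add: mult.assoc[symmetric] ennreal_mult[symmetric] power_mult_distrib[symmetric])
      finally show "(\<integral>\<^sup>+z. g x (x + (1 / m) *\<^sub>R z) \<partial>lborel) = ennreal (real m ^ DIM('a)) * (\<integral>\<^sup>+y. g x y \<partial>lborel)"
        by simp
    qed
    finally show ?thesis
      by (simp add: nn_integral_cmult energy)
  qed
  have pointwise: "ennreal (\<bar>v x - v (x + z)\<bar> powr p) * indicator B z * indicator U x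
      \<le> (\<Sum>i<m. ennreal (real m powr (p - 1)) * g (x + (real i / m) *\<^sub>R z) (x + (real i / m) *\<^sub>R z + (1 / m) *\<^sub>R z))"
    for x z
  proof (cases "x \<in> U \<and> z \<in> B")
    case True
    define y where "y i = x + (real i / m) *\<^sub>R z" for i
    have y_Suc: "y (Suc i) = y i + (1 / m) *\<^sub>R z" for i
      by (simp add: y_def add_divide_distrib scaleR_left_distrib add_ac)
    have yS: "y i \<in> S" if "i \<le> m" for i
      unfolding y_def using True m that by (intro ray) auto
    have "norm ((1 / m) *\<^sub>R z) \<le> r"
      using short[of z] True m by (simp add: divide_simps mult.commute)
    then have "dist (y i) (y (Suc i)) \<le> r" for i
      unfolding y_Suc dist_norm by simp
    then have g: "g (y i) (y i + (1 / m) *\<^sub>R z) = ennreal (\<bar>v (y i) - v (y (Suc i))\<bar> powr p)" if "i < m" for i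
      using yS[of i] yS[of "Suc i"] that unfolding g_def y_Suc[symmetric] by simp
    have "\<bar>v x - v (x + z)\<bar> = \<bar>\<Sum>i<m. v (y i) - v (y (Suc i))\<bar>"
      using m by (subst sum_lessThan_telescope') (simp add: y_def)
    then have "\<bar>v x - v (x + z)\<bar> powr p \<le> real m powr (p - 1) * (\<Sum>i<m. \<bar>v (y i) - v (y (Suc i))\<bar> powr p)"
      using abs_sum_powr_le[OF p m, of "\<lambda>i. v (y i) - v (y (Suc i))"] by simp
    then have "ennreal (\<bar>v x - v (x + z)\<bar> powr p) \<le> ennreal (\<Sum>i<m. real m powr (p - 1) * \<bar>v (y i) - v (y (Suc i))\<bar> powr p)"
      by (intro ennreal_leI) (simp add: sum_distrib_left)
    also have "\<dots> = (\<Sum>i<m. ennreal (real m powr (p - 1)) * g (y i) (y i + (1 / m) *\<^sub>R z))"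
      by (subst sum_ennreal[symmetric]) (auto intro!: sum.cong simp: g ennreal_mult)
    finally show ?thesis using True unfolding y_def by simp
  qed auto
  have "(\<integral>\<^sup>+x\<in>U. \<integral>\<^sup>+z\<in>B. ennreal (\<bar>v x - v (x + z)\<bar> powr p) \<partial>lborel \<partial>lborel)
    = (\<integral>\<^sup>+x. \<integral>\<^sup>+z. ennreal (\<bar>v x - v (x + z)\<bar> powr p) * indicator B z * indicator U x \<partial>lborel \<partial>lborel)"
    by (subst nn_integral_multc[symmetric]) auto
  also have "\<dots> \<le> (\<integral>\<^sup>+x. \<integral>\<^sup>+z. (\<Sum>i<m. ennreal (real m powr (p - 1)) *
      g (x + (real i / m) *\<^sub>R z) (x + (real i / m) *\<^sub>R z + (1 / m) *\<^sub>R z)) \<partial>lborel \<partial>lborel)"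
    by (intro nn_integral_mono pointwise)
  also have "\<dots> = (\<Sum>i<m. ennreal (real m powr (p - 1)) * (\<integral>\<^sup>+x. \<integral>\<^sup>+z.
      g (x + (real i / m) *\<^sub>R z) (x + (real i / m) *\<^sub>R z + (1 / m) *\<^sub>R z) \<partial>lborel \<partial>lborel))"
    by (simp add: nn_integral_sum nn_integral_cmult)
  also have "\<dots> = (\<Sum>i<m. ennreal (real m powr (p - 1)) * (ennreal (real m ^ DIM('a)) * nonlocal_energy p S r v))"
    by (simp only: step)
  also have "\<dots> = ennreal (real m * (real m powr (p - 1) * real m ^ DIM('a))) * nonlocal_energy p S r v"
    by (simp add: ennreal_mult' mult.assoc ennreal_of_nat_eq_real_of_nat)
  also have "real m * (real m powr (p - 1) * real m ^ DIM('a)) = real m powr (p + DIM('a))"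
    using m by (simp add: powr_add powr_diff powr_realpow)
  finally show ?thesis .
qed

section \<open>Averages against a tent function\<close>

text \<open>
  A Lipschitz weight that vanishes outside \<open>ball c s\<close>.  Averages against the indicator function of the
  ball would not do: for \<open>p = 1\<close> a sequence that is bounded in \<open>L\<^sup>1\<close> need not be equi-integrable, and
  its averages over balls need not be equicontinuous.
\<close>

definition tent :: "'a::euclidean_space \<Rightarrow> real \<Rightarrow> 'a \<Rightarrow> real" where
  "tent c s z = max 0 (1 - norm (z - c) / s)"

definition tent_mass :: "'a::euclidean_space \<Rightarrow> real \<Rightarrow> real" where
  "tent_mass c s = (\<integral>z. tent c s z \<partial>lborel)"

text \<open>
  The centre \<open>c\<close> is a displacement: \<open>v\<close> is averaged near \<open>x + c\<close> and not near \<open>x\<close>.  This leaves the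
  freedom to look from \<open>x\<close> only in directions that point into the domain.
\<close>

definition tent_average :: "'a::euclidean_space \<Rightarrow> real \<Rightarrow> ('a \<Rightarrow> real) \<Rightarrow> 'a \<Rightarrow> real" where
  "tent_average c s v x = (\<integral>z. tent c s z * v (x + z) \<partial>lborel) / tent_mass c s"

lemma tent_measurable [measurable]: "tent c s \<in> borel_measurable borel"
  unfolding tent_def[abs_def] by measurable

lemma tent_nonneg: "0 \<le> tent c s z"
  by (simp add: tent_def)

lemma abs_tent [simp]: "\<bar>tent c s z\<bar> = tent c s z"
  by (simp add: tent_nonneg)

lemma tent_le_indicator:
  assumes "0 < s"
  shows "tent c s z \<le> indicator (ball c s) z"
  using assms by (auto simp: tent_def indicator_def dist_norm norm_minus_commute)

lemma tent_le_1: "0 < s \<Longrightarrow> tent c s z \<le> 1"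
  by (simp add: tent_def)

lemma tent_lipschitz:
  assumes "0 < s"
  shows "\<bar>tent c s x - tent c s y\<bar> \<le> norm (x - y) / s"
proof -
  have "\<bar>tent c s x - tent c s y\<bar> \<le> \<bar>norm (x - c) / s - norm (y - c) / s\<bar>"
    unfolding tent_def by linarith
  also have "\<dots> = \<bar>norm (x - c) - norm (y - c)\<bar> / s"
    using assms by (simp flip: diff_divide_distrib)
  also have "\<dots> \<le> norm (x - y) / s"
    using assms norm_triangle_ineq3[of "x - c" "y - c"] by (simp add: divide_right_mono)
  finally show ?thesis .
qed

lemma integrable_tent:
  assumes "0 < s"
  shows "integrable lborel (tent c s)"
proof (rule Bochner_Integration.integrable_bound)
  show "integrable lborel (indicator (ball c s) :: _ \<Rightarrow> real)"
    by (intro integrable_real_indicator emeasure_bounded_finite) auto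
  show "AE z in lborel. norm (tent c s z) \<le> norm (indicator (ball c s) z :: real)"
    using tent_le_indicator[OF assms] tent_nonneg by auto
qed auto

lemma integrable_tent_mult:
  assumes "0 < s" and [measurable]: "w \<in> borel_measurable borel" and "\<And>z. \<bar>w z\<bar> \<le> b"
  shows "integrable lborel (\<lambda>z. tent c s z * w z)"
proof (rule Bochner_Integration.integrable_bound)
  show "integrable lborel (\<lambda>z. b * tent c s z)"
    by (simp add: integrable_tent[OF assms(1)])
  show "AE z in lborel. norm (tent c s z * w z) \<le> norm (b * tent c s z)"
  proof (rule AE_I2)
    fix z
    have "\<bar>w z\<bar> \<le> \<bar>b\<bar>" using assms(3)[of z] by simp
    then show "norm (tent c s z * w z) \<le> norm (b * tent c s z)"
      by (simp add: abs_mult mult.commute[of _ "tent c s z"] mult_left_mono tent_nonneg)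
  qed
qed auto

text \<open>
  The tent is at least \<open>1/2\<close> on the concentric ball of half the radius.
\<close>

lemma tent_mass_lower_bound:
  fixes c :: "'a::euclidean_space"
  assumes "0 < s"
  shows "unit_ball_vol (DIM('a)) * (s / 2) ^ DIM('a) / 2 \<le> tent_mass c s"
proof -
  have "unit_ball_vol (DIM('a)) * (s / 2) ^ DIM('a) / 2 = (\<integral>z. 1 / 2 * indicator (ball c (s / 2)) z \<partial>lborel)"
    using assms by (simp add: content_ball)
  also have "\<dots> \<le> tent_mass c s"
    unfolding tent_mass_def
  proof (rule integral_mono)
    show "integrable lborel (\<lambda>z. 1 / 2 * indicator (ball c (s / 2)) z :: real)"
      by (intro integrable_mult_right integrable_real_indicator emeasure_bounded_finite) auto
    show "1 / 2 * indicator (ball c (s / 2)) z \<le> tent c s z" for z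
      using assms by (auto simp: indicator_def tent_def dist_norm norm_minus_commute divide_simps)
  qed (rule integrable_tent[OF assms])
  finally show ?thesis .
qed

lemma tent_mass_pos:
  fixes c :: "'a::euclidean_space"
  assumes "0 < s"
  shows "0 < tent_mass c s"
proof -
  have "0 < unit_ball_vol (DIM('a)) * (s / 2) ^ DIM('a) / 2"
    using assms by simp
  then show ?thesis
    using tent_mass_lower_bound[OF assms, of c] by linarith
qed

text \<open>
  Jensen's inequality for the probability measure whose density is the normalised tent.
\<close>

lemma tent_average_jensen:
  fixes v :: "'a::euclidean_space \<Rightarrow> real"
  assumes "0 < s" and [measurable]: "v \<in> borel_measurable borel" and b: "\<And>z. \<bar>v z\<bar> \<le> b" and p: "1 \<le> p"
  shows "ennreal (\<bar>v x - tent_average c s v x\<bar> powr p)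
    \<le> ennreal (1 / tent_mass c s) * (\<integral>\<^sup>+z\<in>ball c s. ennreal (\<bar>v x - v (x + z)\<bar> powr p) \<partial>lborel)"
proof -
  let ?\<kappa> = "tent_mass c s"
  have \<kappa>: "0 < ?\<kappa>" by (rule tent_mass_pos[OF assms(1)])
  define M where "M = density lborel (\<lambda>z. ennreal (tent c s z / ?\<kappa>))"
  have [measurable_cong]: "sets M = sets borel" by (simp add: M_def)
  have "emeasure M (space M) = (\<integral>\<^sup>+z. ennreal (tent c s z / ?\<kappa>) \<partial>lborel)"
    by (simp add: M_def emeasure_density)
  also have "\<dots> = ennreal (\<integral>z. tent c s z / ?\<kappa> \<partial>lborel)"
    using \<kappa> tent_nonneg[of c s]
    by (intro nn_integral_eq_integral integrable_divide integrable_tent assms) auto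
  also have "\<dots> = 1"
    using \<kappa> by (simp add: tent_mass_def)
  finally interpret prob_space M by (rule prob_spaceI)
  have int: "integrable M w \<and> expectation w = (\<integral>z. tent c s z * w z \<partial>lborel) / ?\<kappa>"
    if [measurable]: "w \<in> borel_measurable borel" and w: "\<And>z. \<bar>w z\<bar> \<le> B" for w :: "'a \<Rightarrow> real" and B
  proof
    have I: "integrable lborel (\<lambda>z. tent c s z * w z)"
      by (rule integrable_tent_mult[OF assms(1) _ w]) measurable
    show "integrable M w"
      unfolding M_def using I \<kappa> tent_nonneg[of c s]
      by (subst integrable_density) (auto simp: mult.commute[of _ "w _"])
    show "expectation w = (\<integral>z. tent c s z * w z \<partial>lborel) / ?\<kappa>"
      unfolding M_def using \<kappa> tent_nonneg[of c s]
      by (subst integral_density) auto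
  qed
  have bound: "\<bar>v x - v (x + z)\<bar> \<le> 2 * b" for z
    using b[of x] b[of "x + z"] by linarith
  have bound_p: "\<bar>\<bar>v x - v (x + z)\<bar> powr p\<bar> \<le> (2 * b) powr p" for z
    using bound[of z] p by (simp add: powr_mono2)
  have avg: "expectation (\<lambda>z. v x - v (x + z)) = v x - tent_average c s v x"
  proof -
    have "expectation (\<lambda>z. v x - v (x + z)) = expectation (\<lambda>z. v x) - expectation (\<lambda>z. v (x + z))"
      using int[of "\<lambda>z. v (x + z)" b] b by (intro Bochner_Integration.integral_diff) auto
    then show ?thesis
      using int[of "\<lambda>z. v (x + z)" b] b by (simp add: prob_space tent_average_def)
  qed
  have "\<bar>v x - tent_average c s v x\<bar> powr p \<le> expectation (\<lambda>z. \<bar>v x - v (x + z)\<bar> powr p)"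
    unfolding avg[symmetric]
    using int[of "\<lambda>z. v x - v (x + z)", OF _ bound] int[of "\<lambda>z. \<bar>v x - v (x + z)\<bar> powr p", OF _ bound_p]
    by (intro jensens_inequality[of _ UNIV] convex_on_abs_powr p) auto
  also have "\<dots> = (\<integral>z. tent c s z * \<bar>v x - v (x + z)\<bar> powr p \<partial>lborel) / ?\<kappa>"
    using int[of "\<lambda>z. \<bar>v x - v (x + z)\<bar> powr p", OF _ bound_p] by simp
  finally have "ennreal (\<bar>v x - tent_average c s v x\<bar> powr p)
      \<le> ennreal (1 / ?\<kappa>) * ennreal (\<integral>z. tent c s z * \<bar>v x - v (x + z)\<bar> powr p \<partial>lborel)"
    using \<kappa> by (subst ennreal_mult'[symmetric]) (auto intro!: ennreal_leI)
  also have "ennreal (\<integral>z. tent c s z * \<bar>v x - v (x + z)\<bar> powr p \<partial>lborel)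
      = (\<integral>\<^sup>+z. ennreal (tent c s z * \<bar>v x - v (x + z)\<bar> powr p) \<partial>lborel)"
    using tent_nonneg[of c s] bound_p
    by (intro nn_integral_eq_integral[symmetric] integrable_tent_mult assms(1)) auto
  finally have *: "ennreal (\<bar>v x - tent_average c s v x\<bar> powr p)
      \<le> ennreal (1 / ?\<kappa>) * (\<integral>\<^sup>+z. ennreal (tent c s z * \<bar>v x - v (x + z)\<bar> powr p) \<partial>lborel)" .
  have "(\<integral>\<^sup>+z. ennreal (tent c s z * \<bar>v x - v (x + z)\<bar> powr p) \<partial>lborel)
      \<le> (\<integral>\<^sup>+z\<in>ball c s. ennreal (\<bar>v x - v (x + z)\<bar> powr p) \<partial>lborel)"
  proof (rule nn_integral_mono)
    fix z
    show "ennreal (tent c s z * \<bar>v x - v (x + z)\<bar> powr p)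
        \<le> ennreal (\<bar>v x - v (x + z)\<bar> powr p) * indicator (ball c s) z"
    proof (cases "z \<in> ball c s")
      case True
      then show ?thesis
        by (auto intro!: ennreal_leI mult_left_le_one_le tent_nonneg tent_le_1 assms(1))
    next
      case False
      then have "tent c s z = 0"
        using tent_le_indicator[OF assms(1), of c z] tent_nonneg[of c s z] by simp
      then show ?thesis by simp
    qed
  qed
  then have "ennreal (1 / ?\<kappa>) * (\<integral>\<^sup>+z. ennreal (tent c s z * \<bar>v x - v (x + z)\<bar> powr p) \<partial>lborel)
      \<le> ennreal (1 / ?\<kappa>) * (\<integral>\<^sup>+z\<in>ball c s. ennreal (\<bar>v x - v (x + z)\<bar> powr p) \<partial>lborel)"
    by (rule mult_left_mono) simp
  with * show ?thesis by (rule order_trans)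
qed

text \<open>
  In this form \<open>x\<close> occurs only in the weight, so the average inherits the regularity of the tent.
\<close>

lemma tent_average_translate:
  fixes v :: "'a::euclidean_space \<Rightarrow> real"
  assumes [measurable]: "v \<in> borel_measurable borel"
  shows "tent_average c s v x = (\<integral>z. tent c s (z - x) * v z \<partial>lborel) / tent_mass c s"
proof -
  have "(\<integral>z. tent c s (z - x) * v z \<partial>lborel) = (\<integral>z. tent c s (z - x) * v z \<partial>(distr lborel borel ((+) x)))"
    by (simp add: lborel_distr_plus)
  also have "\<dots> = (\<integral>z. tent c s z * v (x + z) \<partial>lborel)"
    by (subst integral_distr) auto
  finally show ?thesis by (simp add: tent_average_def)
qed

lemma integrable_tent_translate:
  fixes v :: "'a::euclidean_space \<Rightarrow> real"
  assumes "0 < s" "integrable lborel v"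
  shows "integrable lborel (\<lambda>z. tent c s (z - x) * v z)"
proof (rule Bochner_Integration.integrable_bound[OF assms(2)])
  show "(\<lambda>z. tent c s (z - x) * v z) \<in> borel_measurable lborel"
    using borel_measurable_integrable[OF assms(2)] by simp
  show "AE z in lborel. norm (tent c s (z - x) * v z) \<le> norm (v z)"
    by (intro AE_I2) (simp add: abs_mult mult_left_le_one_le tent_nonneg tent_le_1[OF assms(1)])
qed

lemma tent_average_bound:
  fixes v :: "'a::euclidean_space \<Rightarrow> real"
  assumes "0 < s" "integrable lborel v"
  shows "\<bar>tent_average c s v x\<bar> \<le> (\<integral>z. \<bar>v z\<bar> \<partial>lborel) / tent_mass c s"
proof -
  have [measurable]: "v \<in> borel_measurable borel"
    using borel_measurable_integrable[OF assms(2)] by simp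
  have "\<bar>\<integral>z. tent c s (z - x) * v z \<partial>lborel\<bar> \<le> (\<integral>z. \<bar>tent c s (z - x) * v z\<bar> \<partial>lborel)"
    by (rule integral_abs_bound)
  also have "\<dots> \<le> (\<integral>z. \<bar>v z\<bar> \<partial>lborel)"
    using integrable_tent_translate[OF assms, of c x] assms
    by (intro integral_mono integrable_abs) (auto simp: abs_mult mult_left_le_one_le tent_nonneg tent_le_1[OF assms(1)])
  finally show ?thesis
    using tent_mass_pos[OF assms(1), of c]
    by (simp add: tent_average_translate divide_right_mono)
qed

lemma tent_average_lipschitz:
  fixes v :: "'a::euclidean_space \<Rightarrow> real"
  assumes "0 < s" "integrable lborel v"
  shows "\<bar>tent_average c s v x - tent_average c s v y\<bar>
    \<le> (\<integral>z. \<bar>v z\<bar> \<partial>lborel) / (s * tent_mass c s) * norm (x - y)"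
proof -
  have [measurable]: "v \<in> borel_measurable borel"
    using borel_measurable_integrable[OF assms(2)] by simp
  note I = integrable_tent_translate[OF assms, of c]
  have "\<bar>(\<integral>z. tent c s (z - x) * v z \<partial>lborel) - (\<integral>z. tent c s (z - y) * v z \<partial>lborel)\<bar>
      = \<bar>\<integral>z. tent c s (z - x) * v z - tent c s (z - y) * v z \<partial>lborel\<bar>"
    by (simp add: Bochner_Integration.integral_diff[OF I I])
  also have "\<dots> \<le> (\<integral>z. \<bar>tent c s (z - x) * v z - tent c s (z - y) * v z\<bar> \<partial>lborel)"
    by (rule integral_abs_bound)
  also have "\<dots> \<le> (\<integral>z. norm (x - y) / s * \<bar>v z\<bar> \<partial>lborel)"
  proof (rule integral_mono)
    show "integrable lborel (\<lambda>z. \<bar>tent c s (z - x) * v z - tent c s (z - y) * v z\<bar>)"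
      by (intro integrable_abs Bochner_Integration.integrable_diff I)
    show "integrable lborel (\<lambda>z. norm (x - y) / s * \<bar>v z\<bar>)"
      using assms(2) by simp
    fix z
    have "\<bar>tent c s (z - x) - tent c s (z - y)\<bar> \<le> norm (x - y) / s"
      using tent_lipschitz[OF assms(1), of c "z - x" "z - y"] by (simp add: norm_minus_commute)
    then show "\<bar>tent c s (z - x) * v z - tent c s (z - y) * v z\<bar> \<le> norm (x - y) / s * \<bar>v z\<bar>"
      unfolding left_diff_distrib[symmetric] abs_mult by (intro mult_right_mono) auto
  qed
  finally have "\<bar>(\<integral>z. tent c s (z - x) * v z \<partial>lborel) - (\<integral>z. tent c s (z - y) * v z \<partial>lborel)\<bar>
      \<le> norm (x - y) / s * (\<integral>z. \<bar>v z\<bar> \<partial>lborel)" by simp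
  then have "\<bar>(\<integral>z. tent c s (z - x) * v z \<partial>lborel) - (\<integral>z. tent c s (z - y) * v z \<partial>lborel)\<bar> / tent_mass c s
      \<le> (norm (x - y) / s * (\<integral>z. \<bar>v z\<bar> \<partial>lborel)) / tent_mass c s"
    by (rule divide_right_mono) (use tent_mass_pos[OF assms(1), of c] in simp)
  also have "\<dots> = (\<integral>z. \<bar>v z\<bar> \<partial>lborel) / (s * tent_mass c s) * norm (x - y)"
    by simp
  also have "\<bar>(\<integral>z. tent c s (z - x) * v z \<partial>lborel) - (\<integral>z. tent c s (z - y) * v z \<partial>lborel)\<bar> / tent_mass c s
      = \<bar>tent_average c s v x - tent_average c s v y\<bar>"
    using tent_mass_pos[OF assms(1), of c]
    by (simp add: tent_average_translate abs_divide flip: diff_divide_distrib)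
  finally show ?thesis .
qed

lemma tent_average_error:
  fixes v :: "'a::euclidean_space \<Rightarrow> real"
  assumes [measurable]: "v \<in> borel_measurable borel" "S \<in> sets borel" "U \<in> sets borel"
    and b: "\<And>z. \<bar>v z\<bar> \<le> b" and s: "0 < s" and p: "1 \<le> p" and m: "0 < m"
    and ray: "\<And>x z t. x \<in> U \<Longrightarrow> z \<in> ball c s \<Longrightarrow> 0 \<le> t \<Longrightarrow> t \<le> 1 \<Longrightarrow> x + t *\<^sub>R z \<in> S"
    and short: "\<And>z. z \<in> ball c s \<Longrightarrow> norm z \<le> real m * r"
  shows "(\<integral>\<^sup>+x\<in>U. ennreal (\<bar>v x - tent_average c s v x\<bar> powr p) \<partial>lborel)
    \<le> ennreal (real m powr (p + DIM('a)) / tent_mass c s) * nonlocal_energy p S r v"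
proof -
  have [measurable]: "ball c s \<in> sets borel" by simp
  have "(\<integral>\<^sup>+x\<in>U. ennreal (\<bar>v x - tent_average c s v x\<bar> powr p) \<partial>lborel)
    \<le> (\<integral>\<^sup>+x. ennreal (1 / tent_mass c s) *
        ((\<integral>\<^sup>+z\<in>ball c s. ennreal (\<bar>v x - v (x + z)\<bar> powr p) \<partial>lborel) * indicator U x) \<partial>lborel)"
    unfolding mult.assoc[symmetric]
    by (intro nn_integral_mono mult_right_mono tent_average_jensen[OF s _ b p]) auto
  also have "\<dots> = ennreal (1 / tent_mass c s) *
      (\<integral>\<^sup>+x\<in>U. \<integral>\<^sup>+z\<in>ball c s. ennreal (\<bar>v x - v (x + z)\<bar> powr p) \<partial>lborel \<partial>lborel)"
    by (rule nn_integral_cmult) measurable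
  also have "\<dots> \<le> ennreal (1 / tent_mass c s) *
      (ennreal (real m powr (p + DIM('a))) * nonlocal_energy p S r v)"
    by (intro mult_left_mono nonlocal_chain_estimate p m ray short) auto
  also have "\<dots> = ennreal (real m powr (p + DIM('a)) / tent_mass c s) * nonlocal_energy p S r v"
    using tent_mass_pos[OF s, of c] by (simp add: mult.assoc[symmetric] ennreal_mult[symmetric])
  finally show ?thesis .
qed

section \<open>Completeness of \<open>L\<^sup>p\<close>\<close>

text \<open>
  By the elementary bound \<open>t \<le> a + a\<^sup>1\<^sup>-\<^sup>p t\<^sup>p\<close> for \<open>t \<ge> 0\<close>: \<open>a\<close> is so small that its
  integral is at most \<open>e/2\<close>, and the tolerance in \<open>L\<^sup>p\<close> then compensates the factor \<open>a\<^sup>1\<^sup>-\<^sup>p\<close>.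
\<close>

lemma (in finite_measure) Lp_Cauchy_imp_L1_Cauchy:
  fixes w :: "nat \<Rightarrow> 'a \<Rightarrow> real"
  assumes [measurable]: "\<And>n. w n \<in> borel_measurable M" and p: "1 \<le> p"
    and Cauchy: "\<And>\<delta>. 0 < \<delta> \<Longrightarrow> \<exists>N. \<forall>m\<ge>N. \<forall>n\<ge>N. (\<integral>\<^sup>+x. ennreal (\<bar>w m x - w n x\<bar> powr p) \<partial>M) \<le> ennreal \<delta>"
    and "0 < e"
  shows "\<exists>N. \<forall>m\<ge>N. \<forall>n\<ge>N. (\<integral>x. \<bar>w m x - w n x\<bar> \<partial>M) < e"
proof -
  let ?V = "measure M (space M)"
  define a where "a = e / (2 * (?V + 1))"
  have a: "0 < a" using \<open>0 < e\<close> by (simp add: a_def add_nonneg_pos)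
  define \<delta> where "\<delta> = a powr (p - 1) * e / 4"
  have "0 < \<delta>" using a \<open>0 < e\<close> by (simp add: \<delta>_def)
  from Cauchy[OF this] obtain N where N: "\<And>m n. N \<le> m \<Longrightarrow> N \<le> n \<Longrightarrow>
      (\<integral>\<^sup>+x. ennreal (\<bar>w m x - w n x\<bar> powr p) \<partial>M) \<le> ennreal \<delta>" by blast
  have "(\<integral>x. \<bar>w m x - w n x\<bar> \<partial>M) < e" if "N \<le> m" "N \<le> n" for m n
  proof -
    let ?d = "\<lambda>x. \<bar>w m x - w n x\<bar>"
    have I: "integrable M (\<lambda>x. ?d x powr p)"
      using N[OF that] by (intro integrableI_bounded) (auto simp: le_less_trans)
    have J: "(\<integral>x. ?d x powr p \<partial>M) \<le> \<delta>"
      using N[OF that] \<open>0 < \<delta>\<close> by (subst (asm) nn_integral_eq_integral[OF I]) auto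
    have le: "?d x \<le> a + a powr (1 - p) * ?d x powr p" for x
    proof -
      have "?d x / a \<le> 1 + (?d x / a) powr p"
        using abs_le_one_add_abs_powr[OF p, of "?d x / a"] a by simp
      then have "a * (?d x / a) \<le> a * (1 + (?d x / a) powr p)"
        using a by (intro mult_left_mono) auto
      then show ?thesis
        using a by (simp add: powr_divide powr_diff distrib_left)
    qed
    have "(\<integral>x. ?d x \<partial>M) \<le> (\<integral>x. a + a powr (1 - p) * ?d x powr p \<partial>M)"
    proof (rule integral_mono')
      show "integrable M (\<lambda>x. a + a powr (1 - p) * ?d x powr p)" using I by simp
    qed (use le a in auto)
    also have "\<dots> = a * ?V + a powr (1 - p) * (\<integral>x. ?d x powr p \<partial>M)"
      using I by simp
    also have "\<dots> \<le> a * ?V + a powr (1 - p) * \<delta>"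
      using J by (simp add: mult_left_mono)
    also have "a powr (1 - p) * \<delta> = e / 4"
      using a by (simp add: \<delta>_def powr_diff)
    also have "a * ?V + e / 4 < e"
    proof -
      have "a * ?V \<le> a * (?V + 1)" using a by simp
      also have "\<dots> = e / 2" by (simp add: a_def) (simp add: add_nonneg_eq_0_iff divide_simps)
      finally show ?thesis using \<open>0 < e\<close> by simp
    qed
    finally show ?thesis .
  qed
  then show ?thesis by blast
qed

lemma tendsto_zero_ennrealI:
  fixes F :: "nat \<Rightarrow> ennreal"
  assumes "\<And>\<delta>. 0 < \<delta> \<Longrightarrow> \<exists>N. \<forall>n\<ge>N. F n \<le> ennreal \<delta>"
  shows "F \<longlonglongrightarrow> 0"
proof (rule order_tendstoI)
  fix a :: ennreal
  assume "0 < a"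
  then obtain b where b: "0 < b" "b < a" using dense by blast
  then have "b < \<top>" using top.not_eq_extremum by fastforce
  then have b_eq: "b = ennreal (enn2real b)" by simp
  have "0 < enn2real b" using b \<open>b < \<top>\<close> by (simp add: enn2real_positive_iff)
  from assms[OF this] obtain N where "\<forall>n\<ge>N. F n \<le> b" using b_eq by auto
  then show "eventually (\<lambda>n. F n < a) sequentially"
    using b(2) le_less_trans unfolding eventually_sequentially by metis
qed auto

text \<open>
  Riesz-Fischer: a subsequence converges almost everywhere, and Fatou's lemma turns the Cauchy property
  of the whole sequence into convergence to the pointwise limit.
\<close>

lemma (in finite_measure) Lp_complete:
  fixes w :: "nat \<Rightarrow> 'a \<Rightarrow> real"
  assumes [measurable]: "\<And>n. w n \<in> borel_measurable M" and p: "1 \<le> p"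
    and int: "\<And>n. integrable M (w n)"
    and Cauchy: "\<And>\<delta>. 0 < \<delta> \<Longrightarrow> \<exists>N. \<forall>m\<ge>N. \<forall>n\<ge>N. (\<integral>\<^sup>+x. ennreal (\<bar>w m x - w n x\<bar> powr p) \<partial>M) \<le> ennreal \<delta>"
  shows "\<exists>f \<in> borel_measurable M. (\<lambda>n. \<integral>\<^sup>+x. ennreal (\<bar>w n x - f x\<bar> powr p) \<partial>M) \<longlonglongrightarrow> 0"
proof -
  have "\<exists>N. \<forall>i\<ge>N. \<forall>j\<ge>N. (\<integral>x. norm (w i x - w j x) \<partial>M) < e" if "0 < e" for e
    using Lp_Cauchy_imp_L1_Cauchy[OF assms(1) p Cauchy that] by simp
  then obtain s where s: "strict_mono s" "AE x in M. Cauchy (\<lambda>i. w (s i) x)"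
    by (rule cauchy_L1_AE_cauchy_subseq[OF int])
  define f where "f x = lim (\<lambda>i. w (s i) x)" for x
  have [measurable]: "f \<in> borel_measurable M" unfolding f_def by measurable
  have f: "AE x in M. (\<lambda>i. w (s i) x) \<longlonglongrightarrow> f x"
    using s(2) unfolding f_def Cauchy_convergent_iff convergent_LIMSEQ_iff .
  have "(\<lambda>n. \<integral>\<^sup>+x. ennreal (\<bar>w n x - f x\<bar> powr p) \<partial>M) \<longlonglongrightarrow> 0"
  proof (rule tendsto_zero_ennrealI)
    fix \<delta> :: real
    assume "0 < \<delta>"
    from Cauchy[OF this] obtain N where N: "\<And>m n. N \<le> m \<Longrightarrow> N \<le> n \<Longrightarrow>
        (\<integral>\<^sup>+x. ennreal (\<bar>w m x - w n x\<bar> powr p) \<partial>M) \<le> ennreal \<delta>" by blast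
    have "(\<integral>\<^sup>+x. ennreal (\<bar>w n x - f x\<bar> powr p) \<partial>M) \<le> ennreal \<delta>" if "N \<le> n" for n
    proof -
      have "(\<integral>\<^sup>+x. ennreal (\<bar>w n x - f x\<bar> powr p) \<partial>M)
          = (\<integral>\<^sup>+x. liminf (\<lambda>i. ennreal (\<bar>w n x - w (s i) x\<bar> powr p)) \<partial>M)"
      proof (rule nn_integral_cong_AE, use f in eventually_elim)
        fix x
        assume "(\<lambda>i. w (s i) x) \<longlonglongrightarrow> f x"
        then have "(\<lambda>i. \<bar>w n x - w (s i) x\<bar>) \<longlonglongrightarrow> \<bar>w n x - f x\<bar>"
          by (intro tendsto_intros)
        then have "(\<lambda>i. ennreal (\<bar>w n x - w (s i) x\<bar> powr p)) \<longlonglongrightarrow> ennreal (\<bar>w n x - f x\<bar> powr p)"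
          by (rule tendsto_ennrealI[OF tendsto_powr2[OF _ tendsto_const]]) (use p in auto)
        then show "ennreal (\<bar>w n x - f x\<bar> powr p) = liminf (\<lambda>i. ennreal (\<bar>w n x - w (s i) x\<bar> powr p))"
          by (intro lim_imp_Liminf[symmetric]) auto
      qed
      also have "\<dots> \<le> liminf (\<lambda>i. \<integral>\<^sup>+x. ennreal (\<bar>w n x - w (s i) x\<bar> powr p) \<partial>M)"
        by (rule nn_integral_liminf) measurable
      also have "\<dots> \<le> ennreal \<delta>"
      proof (rule Liminf_le)
        \<comment> \<open>Here \<open>s i \<ge> i\<close>, so the members of the subsequence with \<open>i \<ge> N\<close> lie in the tail.\<close>
        show "\<forall>\<^sub>F i in sequentially. (\<integral>\<^sup>+x. ennreal (\<bar>w n x - w (s i) x\<bar> powr p) \<partial>M) \<le> ennreal \<delta>"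
          unfolding eventually_sequentially
          by (intro exI[of _ N] allI impI N[OF that] order_trans[OF _ seq_suble[OF s(1)]])
      qed simp
      finally show ?thesis .
    qed
    then show "\<exists>N. \<forall>n\<ge>N. (\<integral>\<^sup>+x. ennreal (\<bar>w n x - f x\<bar> powr p) \<partial>M) \<le> ennreal \<delta>" by blast
  qed
  then show ?thesis by (intro bexI[of _ f]) auto
qed

section \<open>Interior cones of Lipschitz domains\<close>

text \<open>
  The point of the definition is uniformity: one truncated cone, with axis \<open>e\<close>, opening \<open>\<theta>\<close> and height
  \<open>h\<close>, serves as an inward cone at all points of \<open>S\<close> near \<open>x0\<close> simultaneously.
\<close>

definition interior_cone_at :: "'a::euclidean_space set \<Rightarrow> 'a \<Rightarrow> bool" where
  "interior_cone_at S x0 \<longleftrightarrow>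
     (\<exists>e. norm e = 1 \<and> (\<exists>\<theta>>0. \<theta> \<le> 1 \<and> (\<exists>\<rho>>0. \<exists>h>0.
        \<forall>x \<in> S \<inter> ball x0 \<rho>. \<forall>t\<in>{0..h}. \<forall>b\<in>ball 0 \<theta>. x + t *\<^sub>R (e + b) \<in> S)))"

lemma interior_cone_at_interior:
  fixes S :: "'a::euclidean_space set"
  assumes "open S" "x0 \<in> S"
  shows "interior_cone_at S x0"
proof -
  from assms obtain \<rho> where \<rho>: "0 < \<rho>" "ball x0 \<rho> \<subseteq> S" by (auto simp: open_contains_ball)
  obtain e :: 'a where e: "norm e = 1"
    using norm_Basis nonempty_Basis by blast
  have "x + t *\<^sub>R (e + b) \<in> S" if "x \<in> ball x0 (\<rho> / 2)" "t \<in> {0..\<rho> / 4}" "b \<in> ball 0 1" for x t b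
  proof -
    have "norm (e + b) \<le> 2" using that(3) e norm_triangle_ineq[of e b] by simp
    then have "norm (t *\<^sub>R (e + b)) \<le> (\<rho> / 4) * 2"
      unfolding norm_scaleR using that(2) by (intro mult_mono) auto
    then have "dist x0 (x + t *\<^sub>R (e + b)) < \<rho>"
      using that(1) dist_triangle[of x0 "x + t *\<^sub>R (e + b)" x] by (simp add: dist_norm)
    then show ?thesis using \<rho>(2) by auto
  qed
  then show ?thesis
    unfolding interior_cone_at_def using e \<rho>(1)
    by (intro exI[of _ e] conjI exI[of _ "1::real"] exI[of _ "\<rho> / 2"] exI[of _ "\<rho> / 4"]) auto
qed

text \<open>
  Moving up by \<open>t\<close> along the axis with a lateral deviation of at most \<open>t \<theta>\<close> raises the graph by at most
  \<open>L t \<theta>\<close>, and the point itself by at least \<open>t (1 - \<theta>)\<close>.  The opening \<open>\<theta> = 1 / (1 + L)\<close> makes these two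
  equal.
\<close>

lemma interior_cone_at_lipschitz_graph:
  fixes S :: "'a::euclidean_space set"
  assumes r: "0 < r" and e: "norm e = 1" and lip: "L-lipschitz_on {y. y \<bullet> e = 0} \<phi>"
    and graph: "S \<inter> ball x0 r = {x \<in> ball x0 r. \<phi> (x - (x \<bullet> e) *\<^sub>R e) < x \<bullet> e}"
  shows "interior_cone_at S x0"
proof -
  define \<theta> where "\<theta> = 1 / (1 + L)"
  have L: "0 \<le> L" using lip by (rule lipschitz_on_nonneg)
  have \<theta>: "0 < \<theta>" "\<theta> \<le> 1" "L * \<theta> = 1 - \<theta>"
    using L by (auto simp: \<theta>_def field_simps)
  have ee: "e \<bullet> e = 1" using e by (simp add: dot_square_norm)
  define \<pi> where "\<pi> x = x - (x \<bullet> e) *\<^sub>R e" for x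
  have \<pi>_orth: "\<pi> x \<in> {y. y \<bullet> e = 0}" for x
    by (simp add: \<pi>_def inner_diff_left ee)
  have \<pi>_norm: "norm (\<pi> x) \<le> norm x" for x
  proof -
    have "norm (\<pi> x) ^ 2 = norm x ^ 2 - (x \<bullet> e)\<^sup>2"
      unfolding power2_norm_eq_inner \<pi>_def
      by (simp add: inner_diff_left inner_diff_right ee inner_commute power2_eq_square)
    then have "norm (\<pi> x) ^ 2 \<le> norm x ^ 2" by simp
    then show ?thesis by (rule power2_le_imp_le) simp
  qed
  have "x + t *\<^sub>R (e + b) \<in> S" if "x \<in> S \<inter> ball x0 (r / 2)" "t \<in> {0..r / 4}" "b \<in> ball 0 \<theta>" for x t b
  proof -
    let ?y = "x + t *\<^sub>R (e + b)"
    have b: "norm b < \<theta>" using that(3) by simp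
    have "norm (e + b) \<le> 2" using b \<theta> e norm_triangle_ineq[of e b] by simp
    then have "norm (t *\<^sub>R (e + b)) \<le> (r / 4) * 2"
      unfolding norm_scaleR using that(2) by (intro mult_mono) auto
    then have y: "?y \<in> ball x0 r"
      using that(1) dist_triangle[of x0 ?y x] by (simp add: dist_norm)
    have "x \<in> S \<inter> ball x0 r" using that(1) r by auto
    from this[unfolded graph] have x: "\<phi> (\<pi> x) < x \<bullet> e"
      by (simp add: \<pi>_def)
    have "\<pi> ?y - \<pi> x = t *\<^sub>R \<pi> b"
      by (simp add: \<pi>_def algebra_simps inner_add_left ee)
    then have "norm (\<pi> ?y - \<pi> x) \<le> t * \<theta>"
      using that(2) \<pi>_norm[of b] b by (simp add: mult_left_mono)
    then have "L * norm (\<pi> ?y - \<pi> x) \<le> L * (t * \<theta>)"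
      using L by (rule mult_left_mono)
    moreover have "\<phi> (\<pi> ?y) - \<phi> (\<pi> x) \<le> L * norm (\<pi> ?y - \<pi> x)"
      using lipschitz_onD[OF lip \<pi>_orth \<pi>_orth, of ?y x] by (simp add: dist_norm)
    moreover have "L * (t * \<theta>) = t * (1 - \<theta>)"
      using \<theta>(3) by (simp add: mult.left_commute)
    moreover have "t * (1 - \<theta>) \<le> t * (1 + b \<bullet> e)"
      using that(2) Cauchy_Schwarz_ineq2[of b e] e b by (intro mult_left_mono) auto
    moreover have "?y \<bullet> e = x \<bullet> e + t * (1 + b \<bullet> e)"
      by (simp add: inner_add_left ee)
    ultimately have "\<phi> (\<pi> ?y) < ?y \<bullet> e" using x by linarith
    then have "?y \<in> S \<inter> ball x0 r"
      unfolding graph using y by (simp add: \<pi>_def)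
    then show ?thesis by blast
  qed
  then show ?thesis
    unfolding interior_cone_at_def using e \<theta> r
    by (intro exI[of _ e] conjI exI[of _ \<theta>] exI[of _ "r / 2"] exI[of _ "r / 4"]) auto
qed

lemma lipschitz_boundary_interior_cone:
  assumes "open \<Omega>" "lipschitz_boundary \<Omega>" "x \<in> closure \<Omega>"
  shows "interior_cone_at \<Omega> x"
proof (cases "x \<in> \<Omega>")
  case True
  then show ?thesis using assms(1) by (rule interior_cone_at_interior[rotated])
next
  case False
  then have "x \<in> frontier \<Omega>" using assms by (simp add: frontier_def interior_open)
  then show ?thesis
    using assms(2) unfolding lipschitz_boundary_def by (blast intro: interior_cone_at_lipschitz_graph)
qed

section \<open>Compactness from bounds on the nonlocal energy\<close>

text \<open>
  The bound on the nonlocal energy at scale \<open>r n\<close> is the one that a function with gradient bounded in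
  \<open>L\<^sup>p\<close> would satisfy: differences are of order \<open>r n\<close>, and the second variable ranges over a ball of volume
  of order \<open>(r n)\<^sup>d\<close>.
\<close>

locale nonlocal_energy_bounded =
  fixes p :: real and S :: "'a::euclidean_space set" and r :: "nat \<Rightarrow> real" and v :: "nat \<Rightarrow> 'a \<Rightarrow> real"
    and N M :: real
  assumes p: "1 \<le> p" and open_S: "open S" and bounded_S: "bounded S"
    and cone: "\<And>x. x \<in> closure S \<Longrightarrow> interior_cone_at S x"
    and meas [measurable]: "\<And>n. v n \<in> borel_measurable borel"
    and bdd: "\<And>n. \<exists>b. \<forall>x. \<bar>v n x\<bar> \<le> b"
    and supp: "\<And>n x. x \<notin> S \<Longrightarrow> v n x = 0"
    and N: "0 \<le> N" "\<And>n. (\<integral>\<^sup>+x. ennreal (\<bar>v n x\<bar> powr p) \<partial>lborel) \<le> ennreal N"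
    and M: "0 \<le> M" "\<And>n. nonlocal_energy p S (r n) (v n) \<le> ennreal (M * r n powr (p + DIM('a)))"
    and r: "\<And>n. 0 < r n" "r \<longlonglongrightarrow> 0"
begin

lemma S_measurable [measurable]: "S \<in> sets borel"
  using open_S by simp

lemma emeasure_S: "emeasure lborel S = ennreal (measure lborel S)"
  using emeasure_bounded_finite[OF bounded_S] by (simp add: emeasure_eq_ennreal_measure)

lemma integrable_indicator_S: "integrable lborel (indicator S :: 'a \<Rightarrow> real)"
  using emeasure_bounded_finite[OF bounded_S] by (intro integrable_real_indicator) auto

lemma integrable_powr: "integrable lborel (\<lambda>x. \<bar>v n x\<bar> powr p)"
  using N(2)[of n] by (intro integrableI_bounded) (auto intro: le_less_trans)

lemma integral_powr_le: "(\<integral>x. \<bar>v n x\<bar> powr p \<partial>lborel) \<le> N"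
  using N(2)[of n] N(1) by (subst (asm) nn_integral_eq_integral[OF integrable_powr]) auto

lemma abs_le_powr: "\<bar>v n x\<bar> \<le> indicator S x + \<bar>v n x\<bar> powr p"
  using abs_le_one_add_abs_powr[OF p, of "v n x"] supp[of x n] by (cases "x \<in> S") auto

lemma integrable_v: "integrable lborel (v n)"
proof (rule Bochner_Integration.integrable_bound)
  show "integrable lborel (\<lambda>x. indicator S x + \<bar>v n x\<bar> powr p)"
    by (intro Bochner_Integration.integrable_add integrable_indicator_S integrable_powr)
  show "AE x in lborel. norm (v n x) \<le> norm (indicator S x + \<bar>v n x\<bar> powr p)"
    using abs_le_powr[of n] by (intro AE_I2) (auto intro: order_trans)
qed simp

lemma L1_bound: "(\<integral>x. \<bar>v n x\<bar> \<partial>lborel) \<le> measure lborel S + N"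
proof -
  have "(\<integral>x. \<bar>v n x\<bar> \<partial>lborel) \<le> (\<integral>x. indicator S x + \<bar>v n x\<bar> powr p \<partial>lborel)"
    by (intro integral_mono abs_le_powr integrable_abs integrable_v
        Bochner_Integration.integrable_add integrable_indicator_S integrable_powr)
  also have "\<dots> = measure lborel S + (\<integral>x. \<bar>v n x\<bar> powr p \<partial>lborel)"
    using integrable_indicator_S integrable_powr by simp
  finally show ?thesis using integral_powr_le[of n] by linarith
qed

text \<open>
  At scale \<open>h\<close> the \<open>p\<close>-th power of the error is at most \<open>C h\<^sup>p\<close>, with \<open>C\<close> independent of \<open>n\<close>, once \<open>r n < h\<close>.  The tent is
  centred at height \<open>h\<close> on the axis of the interior cone and has radius \<open>\<theta> h\<close>, so that all segments from a
  point of \<open>S\<close> to its translates by the support remain in \<open>S\<close>.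
\<close>

lemma tent_average_error_small_scale:
  assumes x0: "x0 \<in> closure S"
  obtains \<rho> where "0 < \<rho>"
    "\<And>\<delta>. 0 < \<delta> \<Longrightarrow> \<exists>c s K. 0 < s \<and> (\<forall>n\<ge>K.
       (\<integral>\<^sup>+x\<in>S \<inter> ball x0 \<rho>. ennreal (\<bar>v n x - tent_average c s (v n) x\<bar> powr p) \<partial>lborel) \<le> ennreal \<delta>)"
proof -
  let ?d = "DIM('a)"
  from cone[OF x0] obtain e \<theta> \<rho> h0 where e: "norm e = 1" and \<theta>: "0 < \<theta>" "\<theta> \<le> 1" and \<rho>: "0 < \<rho>" and h0: "0 < h0"
    and ray: "\<And>x t b. x \<in> S \<inter> ball x0 \<rho> \<Longrightarrow> t \<in> {0..h0} \<Longrightarrow> b \<in> ball 0 \<theta> \<Longrightarrow> x + t *\<^sub>R (e + b) \<in> S"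
    unfolding interior_cone_at_def by blast
  define C where "C = M * 3 powr (p + ?d) * 2 * (2 / \<theta>) ^ ?d / unit_ball_vol ?d"
  have C: "0 \<le> C" using M(1) \<theta> by (simp add: C_def)
  have "\<exists>c s K. 0 < s \<and> (\<forall>n\<ge>K.
       (\<integral>\<^sup>+x\<in>S \<inter> ball x0 \<rho>. ennreal (\<bar>v n x - tent_average c s (v n) x\<bar> powr p) \<partial>lborel) \<le> ennreal \<delta>)"
    if \<delta>: "0 < \<delta>" for \<delta>
  proof -
    \<comment> \<open>The scale is so small that the cone reaches height \<open>h\<close> and the error \<open>C h\<^sup>p\<close> is below \<open>\<delta>\<close>.\<close>
    define h where "h = min h0 ((\<delta> / (C + 1)) powr (1 / p))"
    have h: "0 < h" "h \<le> h0" using h0 \<delta> C by (auto simp: h_def)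
    have Ch: "C * h powr p \<le> \<delta>"
    proof -
      have "h powr p \<le> ((\<delta> / (C + 1)) powr (1 / p)) powr p"
        using h p by (intro powr_mono2) (auto simp: h_def)
      also have "\<dots> = \<delta> / (C + 1)" using p \<delta> C by (simp add: powr_powr)
      finally have "C * h powr p \<le> C * (\<delta> / (C + 1))" using C by (rule mult_left_mono)
      also have "\<dots> \<le> \<delta>" using C \<delta> by (simp add: divide_simps)
      finally show ?thesis .
    qed
    define c where "c = h *\<^sub>R e"
    define s where "s = \<theta> * h"
    have s: "0 < s" using \<theta> h by (simp add: s_def)
    have ball: "\<exists>b\<in>ball 0 \<theta>. z = h *\<^sub>R (e + b)" if "z \<in> ball c s" for z
    proof (intro bexI)
      show "z = h *\<^sub>R (e + (1 / h) *\<^sub>R (z - c))" using h by (simp add: c_def algebra_simps)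
      show "(1 / h) *\<^sub>R (z - c) \<in> ball 0 \<theta>"
        using that h by (simp add: s_def dist_norm norm_minus_commute divide_simps)
    qed
    obtain K where K: "\<And>n. K \<le> n \<Longrightarrow> r n < h"
      using order_tendstoD(2)[OF r(2) h(1)] by (auto simp: eventually_sequentially)
    have "(\<integral>\<^sup>+x\<in>S \<inter> ball x0 \<rho>. ennreal (\<bar>v n x - tent_average c s (v n) x\<bar> powr p) \<partial>lborel) \<le> ennreal \<delta>"
      if n: "K \<le> n" for n
    proof -
      \<comment> \<open>The least number of steps of length \<open>r n\<close> that covers \<open>2 h\<close>; as \<open>r n < h\<close>, it satisfies
        \<open>m r n \<le> 3 h\<close>, which is where the \<open>3\<close> in \<open>C\<close> comes from.\<close>
      define m where "m = nat \<lceil>2 * h / r n\<rceil>"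
      have pos: "0 < 2 * h / r n" using h r(1)[of n] by simp
      then have m: "0 < m" by (simp add: m_def)
      have m_lower: "2 * h \<le> real m * r n"
        using r(1)[of n] by (simp add: m_def pos_divide_le_eq[symmetric] real_nat_ceiling_ge)
      have "real m \<le> 2 * h / r n + 1"
        using pos by (simp add: m_def)
      then have "real m * r n \<le> (2 * h / r n + 1) * r n"
        using r(1)[of n] by (intro mult_right_mono) auto
      then have m_upper: "real m * r n \<le> 3 * h"
        using r(1)[of n] K[OF n] by (simp add: distrib_right)
      obtain b where b: "\<And>x. \<bar>v n x\<bar> \<le> b" using bdd by blast
      have "(\<integral>\<^sup>+x\<in>S \<inter> ball x0 \<rho>. ennreal (\<bar>v n x - tent_average c s (v n) x\<bar> powr p) \<partial>lborel)
          \<le> ennreal (real m powr (p + ?d) / tent_mass c s) * nonlocal_energy p S (r n) (v n)"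
      proof (rule tent_average_error[OF meas _ _ b s p m])
        fix x z t
        assume *: "x \<in> S \<inter> ball x0 \<rho>" "z \<in> ball c s" "0 \<le> t" "t \<le> (1::real)"
        from ball[OF *(2)] obtain b where b: "b \<in> ball 0 \<theta>" "z = h *\<^sub>R (e + b)" by blast
        have "t * h \<le> 1 * h" using *(4) h by (intro mult_right_mono) auto
        then have "t * h \<le> h0" using h by linarith
        then have "t * h \<in> {0..h0}" using *(3) h by simp
        from ray[OF *(1) this b(1)] show "x + t *\<^sub>R z \<in> S" by (simp add: b(2))
      next
        fix z
        assume "z \<in> ball c s"
        from ball[OF this] obtain b where b: "b \<in> ball 0 \<theta>" "z = h *\<^sub>R (e + b)" by blast
        have "norm (e + b) \<le> 2" using b(1) \<theta> e norm_triangle_ineq[of e b] by simp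
        then have "norm z \<le> h * 2" unfolding b(2) norm_scaleR using h by (intro mult_mono) auto
        then show "norm z \<le> real m * r n" using m_lower by simp
      qed auto
      also have "\<dots> \<le> ennreal (real m powr (p + ?d) / tent_mass c s) * ennreal (M * r n powr (p + ?d))"
        by (intro mult_left_mono M(2)) auto
      also have "\<dots> = ennreal (M * (real m * r n) powr (p + ?d) / tent_mass c s)"
        using tent_mass_pos[OF s, of c] M(1) r(1)[of n]
        by (subst ennreal_mult[symmetric]) (auto simp: powr_mult mult_ac)
      also have "\<dots> \<le> ennreal \<delta>"
      proof (rule ennreal_leI)
        have "M * (real m * r n) powr (p + ?d) \<le> M * (3 * h) powr (p + ?d)"
          using m_upper r(1)[of n] p M(1) by (intro mult_left_mono powr_mono2) auto
        then have "M * (real m * r n) powr (p + ?d) / tent_mass c s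
            \<le> M * (3 * h) powr (p + ?d) / (unit_ball_vol ?d * (s / 2) ^ ?d / 2)"
          using tent_mass_lower_bound[OF s, of c] s M(1)
          by (intro frac_le) auto
        also have "\<dots> = C * h powr p"
          using h \<theta> unfolding C_def s_def
          by (simp add: powr_mult powr_add powr_realpow power_mult_distrib power_divide field_simps)
        finally show "M * (real m * r n) powr (p + ?d) / tent_mass c s \<le> \<delta>" using Ch by linarith
      qed
      finally show ?thesis .
    qed
    with s show ?thesis by blast
  qed
  with \<rho> show ?thesis using that by blast
qed

text \<open>
  An approximate Cauchy property: from some index on, any two members of the subsequence \<open>s\<close> have
  \<open>L\<^sup>p(U)\<close> distance at most \<open>\<delta>\<^sup>1\<^sup>/\<^sup>p\<close>.  Unlike convergence, it can be achieved for one tolerance at a time.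
\<close>

definition Lp_tail_within :: "'a set \<Rightarrow> real \<Rightarrow> (nat \<Rightarrow> nat) \<Rightarrow> bool" where
  "Lp_tail_within U \<delta> s \<longleftrightarrow> (\<exists>K. \<forall>m\<ge>K. \<forall>n\<ge>K.
     (\<integral>\<^sup>+x\<in>U. ennreal (\<bar>v (s m) x - v (s n) x\<bar> powr p) \<partial>lborel) \<le> ennreal \<delta>)"

lemma Lp_tail_within_subseq:
  assumes "Lp_tail_within U \<delta> s" "strict_mono q"
  shows "Lp_tail_within U \<delta> (s \<circ> q)"
proof -
  obtain K where "\<And>m n. K \<le> m \<Longrightarrow> K \<le> n \<Longrightarrow>
      (\<integral>\<^sup>+x\<in>U. ennreal (\<bar>v (s m) x - v (s n) x\<bar> powr p) \<partial>lborel) \<le> ennreal \<delta>"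
    using assms(1) unfolding Lp_tail_within_def by blast
  then show ?thesis
    unfolding Lp_tail_within_def o_def
    using order_trans[OF _ seq_suble[OF assms(2)]] by (intro exI[of _ K]) blast
qed

text \<open>
  The sequence is bounded in \<open>L\<^sup>1\<close>, which bounds the averages and their Lipschitz constants.
\<close>

lemma tent_averages_precompact:
  fixes q :: "nat \<Rightarrow> nat"
  assumes s: "0 < s" and e: "0 < e"
  shows "\<exists>k :: nat \<Rightarrow> nat. strict_mono k \<and> (\<exists>K. \<forall>m\<ge>K. \<forall>n\<ge>K. \<forall>x\<in>S.
    \<bar>tent_average c s (v (q (k m))) x - tent_average c s (v (q (k n))) x\<bar> \<le> e)"
proof -
  define B where "B = measure lborel S + N"
  have B: "0 \<le> B" using N(1) by (simp add: B_def)
  have \<kappa>: "0 < tent_mass c s" by (rule tent_mass_pos[OF s])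
  define F where "F n = tent_average c s (v (q n))" for n :: nat
  define L where "L = B / (s * tent_mass c s)"
  have L: "0 \<le> L" using B s \<kappa> by (simp add: L_def)
  have bound: "norm (F n x) \<le> B / tent_mass c s" for n x
  proof -
    have "norm (F n x) \<le> (\<integral>z. \<bar>v (q n) z\<bar> \<partial>lborel) / tent_mass c s"
      unfolding F_def real_norm_def by (rule tent_average_bound[OF s integrable_v])
    also have "\<dots> \<le> B / tent_mass c s"
      using L1_bound[of "q n"] \<kappa> by (intro divide_right_mono) (auto simp: B_def)
    finally show ?thesis .
  qed
  have lip: "norm (F n x - F n y) \<le> L * norm (x - y)" for n x y
  proof -
    have "norm (F n x - F n y) \<le> (\<integral>z. \<bar>v (q n) z\<bar> \<partial>lborel) / (s * tent_mass c s) * norm (x - y)"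
      unfolding F_def real_norm_def by (rule tent_average_lipschitz[OF s integrable_v])
    also have "\<dots> \<le> L * norm (x - y)"
      unfolding L_def using L1_bound[of "q n"] \<kappa> s
      by (intro mult_right_mono divide_right_mono) (auto simp: B_def)
    finally show ?thesis .
  qed
  have equi: "\<exists>d>0. \<forall>n y. y \<in> closure S \<and> norm (x - y) < d \<longrightarrow> norm (F n x - F n y) < \<epsilon>"
    if "0 < \<epsilon>" for x \<epsilon>
  proof (intro exI conjI allI impI)
    show "0 < \<epsilon> / (L + 1)" using L that by simp
    fix n y
    assume "y \<in> closure S \<and> norm (x - y) < \<epsilon> / (L + 1)"
    then have "(L + 1) * norm (x - y) < \<epsilon>" using L by (simp add: pos_less_divide_eq mult.commute)
    then show "norm (F n x - F n y) < \<epsilon>"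
      using lip[of n x y] norm_ge_zero[of "x - y"] unfolding distrib_right by linarith
  qed
  obtain g k where k: "strict_mono (k :: nat \<Rightarrow> nat)"
    and g: "\<And>\<epsilon>. 0 < \<epsilon> \<Longrightarrow> \<exists>K. \<forall>n x. K \<le> n \<and> x \<in> closure S \<longrightarrow> norm (F (k n) x - g x) < \<epsilon>"
    by (rule Arzela_Ascoli[of "closure S" F "B / tent_mass c s"])
       (use bounded_S bound equi in auto)
  from g[of "e / 2"] e obtain K where K: "\<And>n x. K \<le> n \<Longrightarrow> x \<in> closure S \<Longrightarrow> norm (F (k n) x - g x) < e / 2"
    by auto
  show ?thesis
  proof (intro exI conjI allI impI ballI)
    show "strict_mono k" by (rule k)
    fix m n x
    assume "K \<le> m" "K \<le> n" "x \<in> S"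
    then have "norm (F (k m) x - g x) < e / 2" "norm (F (k n) x - g x) < e / 2"
      using K closure_subset[of S] by blast+
    then show "\<bar>tent_average c s (v (q (k m))) x - tent_average c s (v (q (k n))) x\<bar> \<le> e"
      unfolding F_def real_norm_def by linarith
  qed
qed

text \<open>
  Two members of the sequence are compared through their averages: the averages are close to the
  functions by the choice of the scale, and close to each other along a suitable subsequence.
\<close>

lemma Lp_tail_within_near_point:
  assumes x0: "x0 \<in> closure S"
  obtains \<rho> where "0 < \<rho>"
    "\<And>\<delta> (q :: nat \<Rightarrow> nat). 0 < \<delta> \<Longrightarrow> strict_mono q \<Longrightarrow> \<exists>k. strict_mono k \<and> Lp_tail_within (S \<inter> ball x0 \<rho>) \<delta> (q \<circ> k)"
proof -
  from tent_average_error_small_scale[OF x0] obtain \<rho> where \<rho>: "0 < \<rho>" and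
    err: "\<And>\<delta>. 0 < \<delta> \<Longrightarrow> \<exists>c s K. 0 < s \<and> (\<forall>n\<ge>K.
       (\<integral>\<^sup>+x\<in>S \<inter> ball x0 \<rho>. ennreal (\<bar>v n x - tent_average c s (v n) x\<bar> powr p) \<partial>lborel) \<le> ennreal \<delta>)"
    by blast
  let ?U = "S \<inter> ball x0 \<rho>"
  have [measurable]: "?U \<in> sets borel" by simp
  have "\<exists>k. strict_mono k \<and> Lp_tail_within ?U \<delta> (q \<circ> k)" if \<delta>: "0 < \<delta>" and q: "strict_mono q" for \<delta> and q :: "nat \<Rightarrow> nat"
  proof -
    define C where "C = 3 powr (p - 1)"
    have C: "0 < C" by (simp add: C_def)
    define \<delta>' where "\<delta>' = \<delta> / (3 * C)"
    have \<delta>': "0 < \<delta>'" using \<delta> C by (simp add: \<delta>'_def)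
    from err[OF this] obtain c s K where s: "0 < s" and K: "\<And>n. K \<le> n \<Longrightarrow>
        (\<integral>\<^sup>+x\<in>?U. ennreal (\<bar>v n x - tent_average c s (v n) x\<bar> powr p) \<partial>lborel) \<le> ennreal \<delta>'" by blast
    define A where "A n = tent_average c s (v n)" for n
    have "continuous_on UNIV (A n)" for n
    proof (rule lipschitz_on_continuous_on)
      show "((\<integral>z. \<bar>v n z\<bar> \<partial>lborel) / (s * tent_mass c s))-lipschitz_on UNIV (A n)"
        using tent_average_lipschitz[OF s integrable_v[of n], of c] s tent_mass_pos[OF s, of c]
        by (intro lipschitz_onI) (auto simp: A_def dist_norm)
    qed
    then have [measurable]: "A n \<in> borel_measurable borel" for n
      by (rule borel_measurable_continuous_onI)
    define W where "W = measure lborel S"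
    have W: "0 \<le> W" by (simp add: W_def)
    define e where "e = (\<delta>' / (W + 1)) powr (1 / p)"
    have e: "0 < e" using \<delta>' W by (simp add: e_def)
    have e_powr: "e powr p * W \<le> \<delta>'"
    proof -
      have "e powr p = \<delta>' / (W + 1)" using p \<delta>' W by (simp add: e_def powr_powr)
      then have "e powr p * W + e powr p = \<delta>'" using W by (simp add: field_simps)
      then show ?thesis using powr_ge_zero[of e p] by linarith
    qed
    obtain k :: "nat \<Rightarrow> nat" and K' where k: "strict_mono k" and K': "\<And>m n x. K' \<le> m \<Longrightarrow> K' \<le> n \<Longrightarrow> x \<in> S \<Longrightarrow>
        \<bar>A (q (k m)) x - A (q (k n)) x\<bar> \<le> e"
      using tent_averages_precompact[OF s e, of c q] unfolding A_def by metis
    have "(\<integral>\<^sup>+x\<in>?U. ennreal (\<bar>v (q (k m)) x - v (q (k n)) x\<bar> powr p) \<partial>lborel) \<le> ennreal \<delta>"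
      if mn: "max K K' \<le> m" "max K K' \<le> n" for m n
    proof -
      let ?a = "q (k m)" and ?b = "q (k n)"
      have "K \<le> ?a" "K \<le> ?b"
        using mn seq_suble[OF k, of m] seq_suble[OF k, of n] seq_suble[OF q, of "k m"] seq_suble[OF q, of "k n"]
        by linarith+
      note K = K[OF this(1), folded A_def] K[OF this(2), folded A_def]
      have mid: "(\<integral>\<^sup>+x\<in>?U. ennreal (\<bar>A ?a x - A ?b x\<bar> powr p) \<partial>lborel) \<le> ennreal \<delta>'"
      proof -
        have "(\<integral>\<^sup>+x\<in>?U. ennreal (\<bar>A ?a x - A ?b x\<bar> powr p) \<partial>lborel) \<le> (\<integral>\<^sup>+x. ennreal (e powr p) * indicator S x \<partial>lborel)"
          using K'[of m n] mn p
          by (intro nn_integral_mono) (auto simp: indicator_def intro!: ennreal_leI powr_mono2)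
        also have "\<dots> = ennreal (e powr p * W)"
          by (simp add: nn_integral_cmult_indicator emeasure_S W_def ennreal_mult)
        also have "\<dots> \<le> ennreal \<delta>'" using e_powr by (rule ennreal_leI)
        finally show ?thesis .
      qed
      have pointwise: "ennreal (\<bar>v ?a x - v ?b x\<bar> powr p) \<le> ennreal C *
          (ennreal (\<bar>v ?a x - A ?a x\<bar> powr p) + ennreal (\<bar>A ?a x - A ?b x\<bar> powr p) + ennreal (\<bar>v ?b x - A ?b x\<bar> powr p))" for x
      proof -
        have "\<bar>(v ?a x - A ?a x) + (A ?a x - A ?b x) + (A ?b x - v ?b x)\<bar> powr p \<le> C *
          (\<bar>v ?a x - A ?a x\<bar> powr p + \<bar>A ?a x - A ?b x\<bar> powr p + \<bar>A ?b x - v ?b x\<bar> powr p)"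
          unfolding C_def by (rule abs_add3_powr_le[OF p])
        from ennreal_leI[OF this] show ?thesis
          using C by (simp add: ennreal_mult abs_minus_commute[of "A ?b x"])
      qed
      have "(\<integral>\<^sup>+x\<in>?U. ennreal (\<bar>v ?a x - v ?b x\<bar> powr p) \<partial>lborel) \<le> (\<integral>\<^sup>+x. ennreal C *
          (ennreal (\<bar>v ?a x - A ?a x\<bar> powr p) * indicator ?U x + ennreal (\<bar>A ?a x - A ?b x\<bar> powr p) * indicator ?U x
           + ennreal (\<bar>v ?b x - A ?b x\<bar> powr p) * indicator ?U x) \<partial>lborel)"
        using pointwise by (intro nn_integral_mono) (simp add: indicator_def)
      also have "\<dots> = ennreal C * ((\<integral>\<^sup>+x\<in>?U. ennreal (\<bar>v ?a x - A ?a x\<bar> powr p) \<partial>lborel)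
          + (\<integral>\<^sup>+x\<in>?U. ennreal (\<bar>A ?a x - A ?b x\<bar> powr p) \<partial>lborel)
          + (\<integral>\<^sup>+x\<in>?U. ennreal (\<bar>v ?b x - A ?b x\<bar> powr p) \<partial>lborel))"
        by (simp add: nn_integral_cmult nn_integral_add)
      also have "\<dots> \<le> ennreal C * (ennreal \<delta>' + ennreal \<delta>' + ennreal \<delta>')"
        by (intro mult_left_mono add_mono K mid) auto
      also have "\<dots> = ennreal (C * (\<delta>' + \<delta>' + \<delta>'))"
        using C \<delta>' by (simp only: ennreal_mult ennreal_plus add_nonneg_nonneg less_imp_le)
      also have "C * (\<delta>' + \<delta>' + \<delta>') = \<delta>" using C by (simp add: \<delta>'_def)
      finally show ?thesis .
    qed
    then show ?thesis using k unfolding Lp_tail_within_def o_def by blast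
  qed
  with \<rho> that show ?thesis by blast
qed

lemma Lp_tail_within_Un:
  assumes "Lp_tail_within A \<delta> s" "Lp_tail_within B \<delta>' s" "0 \<le> \<delta>" "0 \<le> \<delta>'"
    and [measurable]: "A \<in> sets borel" "B \<in> sets borel"
  shows "Lp_tail_within (A \<union> B) (\<delta> + \<delta>') s"
proof -
  obtain K where K: "\<And>m n. K \<le> m \<Longrightarrow> K \<le> n \<Longrightarrow>
      (\<integral>\<^sup>+x\<in>A. ennreal (\<bar>v (s m) x - v (s n) x\<bar> powr p) \<partial>lborel) \<le> ennreal \<delta>"
    using assms(1) unfolding Lp_tail_within_def by blast
  obtain K' where K': "\<And>m n. K' \<le> m \<Longrightarrow> K' \<le> n \<Longrightarrow>
      (\<integral>\<^sup>+x\<in>B. ennreal (\<bar>v (s m) x - v (s n) x\<bar> powr p) \<partial>lborel) \<le> ennreal \<delta>'"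
    using assms(2) unfolding Lp_tail_within_def by blast
  have "(\<integral>\<^sup>+x\<in>A \<union> B. ennreal (\<bar>v (s m) x - v (s n) x\<bar> powr p) \<partial>lborel) \<le> ennreal (\<delta> + \<delta>')"
    if "max K K' \<le> m" "max K K' \<le> n" for m n
  proof -
    let ?f = "\<lambda>x. ennreal (\<bar>v (s m) x - v (s n) x\<bar> powr p)"
    have "(\<integral>\<^sup>+x\<in>A \<union> B. ?f x \<partial>lborel) \<le> (\<integral>\<^sup>+x. ?f x * indicator A x + ?f x * indicator B x \<partial>lborel)"
      by (intro nn_integral_mono) (auto simp: indicator_def)
    also have "\<dots> = (\<integral>\<^sup>+x\<in>A. ?f x \<partial>lborel) + (\<integral>\<^sup>+x\<in>B. ?f x \<partial>lborel)"
      by (rule nn_integral_add) measurable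
    also have "\<dots> \<le> ennreal \<delta> + ennreal \<delta>'"
      using that by (intro add_mono K K') auto
    finally show ?thesis using assms by simp
  qed
  then show ?thesis unfolding Lp_tail_within_def by blast
qed

lemma exists_subseq_Lp_tail_within:
  fixes q :: "nat \<Rightarrow> nat"
  assumes \<delta>: "0 < \<delta>" and q: "strict_mono q"
  shows "\<exists>k. strict_mono k \<and> Lp_tail_within S \<delta> (q \<circ> k)"
proof -
  have "\<exists>\<rho>>0. \<forall>\<delta> (q :: nat \<Rightarrow> nat). 0 < \<delta> \<longrightarrow> strict_mono q \<longrightarrow>
      (\<exists>k. strict_mono k \<and> Lp_tail_within (S \<inter> ball x \<rho>) \<delta> (q \<circ> k))" if "x \<in> closure S" for x
    using Lp_tail_within_near_point[OF that] by metis
  then obtain \<rho> where \<rho>: "\<And>x. x \<in> closure S \<Longrightarrow> 0 < \<rho> x"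
    and near: "\<And>x \<delta> (q :: nat \<Rightarrow> nat). x \<in> closure S \<Longrightarrow> 0 < \<delta> \<Longrightarrow> strict_mono q \<Longrightarrow>
      \<exists>k. strict_mono k \<and> Lp_tail_within (S \<inter> ball x (\<rho> x)) \<delta> (q \<circ> k)"
    by metis
  have "compact (closure S)" using bounded_S by simp
  then obtain F where F: "F \<subseteq> closure S" "finite F" "closure S \<subseteq> (\<Union>x\<in>F. ball x (\<rho> x))"
  proof (rule compactE_image)
    show "closure S \<subseteq> (\<Union>x\<in>closure S. ball x (\<rho> x))" using \<rho> by force
  qed auto
  have union: "\<forall>\<delta> (q :: nat \<Rightarrow> nat). 0 < \<delta> \<longrightarrow> strict_mono q \<longrightarrow>
      (\<exists>k. strict_mono k \<and> Lp_tail_within (S \<inter> (\<Union>x\<in>F. ball x (\<rho> x))) \<delta> (q \<circ> k))"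
    using F(2,1)
  proof (induction F rule: finite_induct)
    case empty
    have "Lp_tail_within {} \<delta> q" for \<delta> q by (simp add: Lp_tail_within_def)
    moreover have "strict_mono (id :: nat \<Rightarrow> nat)" by (simp add: strict_mono_def)
    ultimately show ?case by (intro allI impI exI[of _ id]) simp
  next
    case (insert x F)
    show ?case
    proof (intro allI impI)
      fix \<delta> :: real and q :: "nat \<Rightarrow> nat"
      assume \<delta>: "0 < \<delta>" and q: "strict_mono q"
      from insert.IH insert.prems \<delta> q obtain k where k: "strict_mono k"
        "Lp_tail_within (S \<inter> (\<Union>x\<in>F. ball x (\<rho> x))) (\<delta> / 2) (q \<circ> k)"
        by (metis half_gt_zero insert_subset)
      have "strict_mono (q \<circ> k)" using q k(1) by (rule strict_mono_o)
      with near[of x "\<delta> / 2"] insert.prems \<delta> obtain k' where k': "strict_mono k'"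
        "Lp_tail_within (S \<inter> ball x (\<rho> x)) (\<delta> / 2) (q \<circ> k \<circ> k')"
        by (metis half_gt_zero insert_subset)
      have "Lp_tail_within (S \<inter> (\<Union>x\<in>F. ball x (\<rho> x))) (\<delta> / 2) (q \<circ> k \<circ> k')"
        by (rule Lp_tail_within_subseq[OF k(2) k'(1)])
      moreover have "S \<inter> (\<Union>x\<in>F. ball x (\<rho> x)) \<in> sets borel"
        by (intro borel_open open_Int open_S) auto
      ultimately have "Lp_tail_within ((S \<inter> ball x (\<rho> x)) \<union> (S \<inter> (\<Union>x\<in>F. ball x (\<rho> x)))) (\<delta> / 2 + \<delta> / 2) (q \<circ> k \<circ> k')"
        using \<delta> k'(2) by (intro Lp_tail_within_Un) auto
      then have "Lp_tail_within (S \<inter> (\<Union>x\<in>insert x F. ball x (\<rho> x))) \<delta> (q \<circ> (k \<circ> k'))"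
        by (simp add: Int_Un_distrib o_assoc)
      then show "\<exists>k. strict_mono k \<and> Lp_tail_within (S \<inter> (\<Union>x\<in>insert x F. ball x (\<rho> x))) \<delta> (q \<circ> k)"
        using strict_mono_o[OF k(1) k'(1)] by blast
    qed
  qed
  have all: "S \<inter> (\<Union>x\<in>F. ball x (\<rho> x)) = S" using F(3) closure_subset by blast
  show ?thesis using union[rule_format, OF \<delta> q] unfolding all .
qed

text \<open>
  The tolerances \<open>1 / (j + 1)\<close> are met one after the other, and the diagonal sequence meets them all.
\<close>

lemma Lp_convergent_subsequence:
  "\<exists>k f. strict_mono k \<and> f \<in> borel_measurable borel \<and>
     (\<lambda>n. \<integral>\<^sup>+x\<in>S. ennreal (\<bar>v (k n) x - f x\<bar> powr p) \<partial>lborel) \<longlonglongrightarrow> 0"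
proof -
  interpret subseqs "\<lambda>j. Lp_tail_within S (1 / real (Suc j))"
    by standard (rule exists_subseq_Lp_tail_within, auto)
  define k where "k = diagseq"
  have k: "strict_mono k" unfolding k_def by (rule subseq_diagseq)
  have Cauchy: "\<exists>K. \<forall>m\<ge>K. \<forall>n\<ge>K. (\<integral>\<^sup>+x\<in>S. ennreal (\<bar>v (k m) x - v (k n) x\<bar> powr p) \<partial>lborel) \<le> ennreal \<delta>"
    if \<delta>: "0 < \<delta>" for \<delta>
  proof -
    from reals_Archimedean[OF \<delta>] obtain j where j: "1 / real (Suc j) < \<delta>"
      by (auto simp: inverse_eq_divide)
    have "Lp_tail_within S (1 / real (Suc j)) (k \<circ> (+) (Suc j))"
      unfolding k_def by (rule diagseq_holds) (rule Lp_tail_within_subseq)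
    then obtain K where K: "\<And>m n. K \<le> m \<Longrightarrow> K \<le> n \<Longrightarrow>
        (\<integral>\<^sup>+x\<in>S. ennreal (\<bar>v (k (Suc j + m)) x - v (k (Suc j + n)) x\<bar> powr p) \<partial>lborel) \<le> ennreal (1 / real (Suc j))"
      unfolding Lp_tail_within_def o_def by blast
    have "(\<integral>\<^sup>+x\<in>S. ennreal (\<bar>v (k m) x - v (k n) x\<bar> powr p) \<partial>lborel) \<le> ennreal \<delta>"
      if "K + Suc j \<le> m" "K + Suc j \<le> n" for m n
      using K[of "m - Suc j" "n - Suc j"] that order_trans[OF _ ennreal_leI[OF less_imp_le[OF j]]] by simp
    then show ?thesis by blast
  qed
  \<comment> \<open>Lebesgue measure concentrated on \<open>S\<close>, as a finite measure on the Borel sets of the whole space.\<close>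
  define \<mu> where "\<mu> = density lborel (\<lambda>x. indicator S x :: ennreal)"
  have [measurable_cong]: "sets \<mu> = sets borel" by (simp add: \<mu>_def)
  interpret finite_measure \<mu>
  proof
    show "emeasure \<mu> (space \<mu>) \<noteq> \<infinity>"
      using emeasure_S by (simp add: \<mu>_def emeasure_density)
  qed
  have to_\<mu>: "(\<integral>\<^sup>+x. f x \<partial>\<mu>) = (\<integral>\<^sup>+x\<in>S. f x \<partial>lborel)" if [measurable]: "f \<in> borel_measurable borel" for f
    unfolding \<mu>_def by (subst nn_integral_density) (auto simp: mult.commute)
  have int: "integrable \<mu> (v (k n))" for n
  proof (rule integrableI_bounded)
    have "(\<integral>\<^sup>+x. ennreal (norm (v (k n) x)) \<partial>\<mu>) \<le> (\<integral>\<^sup>+x. ennreal (norm (v (k n) x)) \<partial>lborel)"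
      by (subst to_\<mu>) (auto intro!: nn_integral_mono simp: indicator_def)
    also have "\<dots> < \<infinity>" using integrable_v[of "k n"] by (simp add: integrable_iff_bounded)
    finally show "(\<integral>\<^sup>+x. ennreal (norm (v (k n) x)) \<partial>\<mu>) < \<infinity>" .
  qed measurable
  have "\<exists>f \<in> borel_measurable \<mu>. (\<lambda>n. \<integral>\<^sup>+x. ennreal (\<bar>v (k n) x - f x\<bar> powr p) \<partial>\<mu>) \<longlonglongrightarrow> 0"
    by (rule Lp_complete[OF _ p int]) (use Cauchy in \<open>auto simp: to_\<mu>\<close>)
  then obtain f where [measurable]: "f \<in> borel_measurable borel"
    and lim: "(\<lambda>n. \<integral>\<^sup>+x. ennreal (\<bar>v (k n) x - f x\<bar> powr p) \<partial>\<mu>) \<longlonglongrightarrow> 0"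
    by (auto simp: measurable_cong_sets[OF \<open>sets \<mu> = sets borel\<close> refl])
  have "(\<lambda>n. \<integral>\<^sup>+x\<in>S. ennreal (\<bar>v (k n) x - f x\<bar> powr p) \<partial>lborel) \<longlonglongrightarrow> 0"
    using lim by (subst (asm) to_\<mu>) auto
  with k show ?thesis by (intro exI[of _ k] exI[of _ f]) auto
qed

end

section \<open>Transport maps and the \<open>TL\<^sup>p\<close> distance\<close>

text \<open>
  A transport map from \<open>\<mu>\<close> to \<open>\<nu>\<close> induces the coupling \<open>(T, id)#\<mu>\<close>, and its cost bounds the infimum.
\<close>

lemma TLp_dist_le_transport_map:
  fixes T :: "'a::euclidean_space \<Rightarrow> 'a"
  assumes \<mu>: "borel_prob_on \<Omega> \<mu>" and \<nu>: "borel_prob_on \<Omega> \<nu>"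
    and T: "T \<in> restrict_space borel \<Omega> \<rightarrow>\<^sub>M restrict_space borel \<Omega>"
    and push: "distr \<mu> (restrict_space borel \<Omega>) T = \<nu>"
    and \<phi>: "\<phi> \<in> borel_measurable \<nu>" and f: "f \<in> borel_measurable \<mu>"
  shows "0 \<le> TLp_dist p (\<phi>, \<nu>) (f, \<mu>)"
    and "TLp_dist p (\<phi>, \<nu>) (f, \<mu>) \<le> (\<integral>x. norm (T x - x) powr p + \<bar>\<phi> (T x) - f x\<bar> powr p \<partial>\<mu>) powr (1 / p)"
proof -
  have sets\<mu> [measurable_cong]: "sets \<mu> = sets (restrict_space borel \<Omega>)"
    and sets\<nu> [measurable_cong]: "sets \<nu> = sets (restrict_space borel \<Omega>)"
    using \<mu> \<nu> by (auto simp: borel_prob_on_def)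
  note [measurable] = T \<phi> f
  have [measurable]: "(\<lambda>x. x) \<in> restrict_space borel \<Omega> \<rightarrow>\<^sub>M borel"
    by (rule measurable_restrict_space1) simp
  define \<gamma> where "\<gamma> = distr \<mu> (\<nu> \<Otimes>\<^sub>M \<mu>) (\<lambda>x. (T x, x))"
  have pair [measurable]: "(\<lambda>x. (T x, x)) \<in> \<mu> \<rightarrow>\<^sub>M \<nu> \<Otimes>\<^sub>M \<mu>" by measurable
  have "distr \<gamma> \<nu> fst = \<nu>"
    unfolding \<gamma>_def by (subst distr_distr) (auto simp: o_def push[symmetric] intro!: distr_cong)
  moreover have "distr \<gamma> \<mu> snd = \<mu>"
    unfolding \<gamma>_def by (subst distr_distr) (auto simp: o_def distr_id2)
  ultimately have \<gamma>: "\<gamma> \<in> couplings \<nu> \<mu>"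
    by (simp add: couplings_def \<gamma>_def)
  let ?F = "\<lambda>\<gamma>. (\<integral>(x, y). norm (x - y) powr p + \<bar>\<phi> x - f y\<bar> powr p \<partial>\<gamma>) powr (1 / p)"
  show "0 \<le> TLp_dist p (\<phi>, \<nu>) (f, \<mu>)"
    unfolding TLp_dist_def using \<gamma> by (auto intro!: cINF_greatest)
  have "TLp_dist p (\<phi>, \<nu>) (f, \<mu>) \<le> ?F \<gamma>"
    unfolding TLp_dist_def using \<gamma> by (auto intro!: cINF_lower bdd_belowI[of _ 0])
  also have "?F \<gamma> = (\<integral>x. norm (T x - x) powr p + \<bar>\<phi> (T x) - f x\<bar> powr p \<partial>\<mu>) powr (1 / p)"
    unfolding \<gamma>_def by (subst integral_distr[OF pair]) auto
  finally show "TLp_dist p (\<phi>, \<nu>) (f, \<mu>) \<le> (\<integral>x. norm (T x - x) powr p + \<bar>\<phi> (T x) - f x\<bar> powr p \<partial>\<mu>) powr (1 / p)" .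
qed

lemma nn_integral_finite_valued:
  assumes "finite V" and [measurable]: "\<Omega> \<in> sets borel"
    and fib [measurable]: "\<And>a. a \<in> V \<Longrightarrow> T -` {a} \<inter> \<Omega> \<in> sets borel" and "T ` \<Omega> \<subseteq> V"
  shows "(\<integral>\<^sup>+x\<in>\<Omega>. g (T x) \<partial>lborel) = (\<Sum>a\<in>V. g a * emeasure lborel (T -` {a} \<inter> \<Omega>))"
proof -
  have "(\<integral>\<^sup>+x\<in>\<Omega>. g (T x) \<partial>lborel) = (\<integral>\<^sup>+x. (\<Sum>a\<in>V. g a * indicator (T -` {a} \<inter> \<Omega>) x) \<partial>lborel)"
  proof (rule nn_integral_cong)
    fix x
    show "g (T x) * indicator \<Omega> x = (\<Sum>a\<in>V. g a * indicator (T -` {a} \<inter> \<Omega>) x)"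
    proof (cases "x \<in> \<Omega>")
      case True
      then have "(\<Sum>a\<in>V. g a * indicator (T -` {a} \<inter> \<Omega>) x) = (\<Sum>a\<in>V. if a = T x then g a else 0)"
        by (intro sum.cong) (auto simp: indicator_def)
      also have "\<dots> = g (T x)" using True assms by (auto simp: sum.delta)
      finally show ?thesis using True by simp
    qed auto
  qed
  also have "\<dots> = (\<Sum>a\<in>V. g a * emeasure lborel (T -` {a} \<inter> \<Omega>))"
    using fib by (subst nn_integral_sum) (auto intro!: sum.cong nn_integral_cmult_indicator)
  finally show ?thesis .
qed

text \<open>
  The situation at a single index \<open>n\<close> of the sequence: \<open>\<nu>\<close> is the discrete measure \<open>\<mu>\<^sub>n\<close>.
\<close>

locale discretised_domain =
  fixes \<Omega> :: "'a::euclidean_space set" and \<mu> :: "'a measure" and \<rho> :: "'a \<Rightarrow> real"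
    and V :: "'a set" and \<nu> :: "'a measure" and T :: "'a \<Rightarrow> 'a" and D :: real
  assumes open_\<Omega>: "open \<Omega>" and bounded_\<Omega>: "bounded \<Omega>"
    and prob: "borel_prob_on \<Omega> \<mu>" "borel_prob_on \<Omega> \<nu>"
    and density: "continuous_on \<Omega> \<rho>" "has_density_on \<Omega> \<mu> \<rho>"
    and density_bounds: "0 < D" "\<And>x. x \<in> \<Omega> \<Longrightarrow> 1 / D \<le> \<rho> x" "\<And>x. x \<in> \<Omega> \<Longrightarrow> \<rho> x \<le> D"
    and V: "finite V" "V \<subseteq> \<Omega>"
    and T: "T \<in> restrict_space borel \<Omega> \<rightarrow>\<^sub>M restrict_space borel \<Omega>" "T ` \<Omega> \<subseteq> V"
      "distr \<mu> (restrict_space borel \<Omega>) T = \<nu>"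
begin

lemma \<Omega>_measurable [measurable]: "\<Omega> \<in> sets borel"
  using open_\<Omega> by simp

lemma sets_\<mu>: "sets \<mu> = sets (restrict_space borel \<Omega>)"
  using prob(1) by (simp add: borel_prob_on_def)

lemma space_\<mu>: "space \<mu> = \<Omega>"
  using sets_eq_imp_space_eq[OF sets_\<mu>] by (simp add: space_restrict_space)

lemma fibre_measurable: "T -` {a} \<inter> \<Omega> \<in> sets borel"
proof -
  have "{a} \<inter> \<Omega> \<in> sets (restrict_space borel \<Omega>)" by (subst sets_restrict_space_iff) auto
  from measurable_sets[OF T(1) this] have "T -` ({a} \<inter> \<Omega>) \<inter> \<Omega> \<in> sets borel"
    by (subst (asm) sets_restrict_space_iff) (auto simp: space_restrict_space)
  moreover have "T -` ({a} \<inter> \<Omega>) \<inter> \<Omega> = T -` {a} \<inter> \<Omega>" using T(2) V(2) by auto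
  ultimately show ?thesis by simp
qed

lemma nn_integral_\<mu>:
  assumes [measurable]: "f \<in> borel_measurable borel"
  shows "(\<integral>\<^sup>+x. f x \<partial>\<mu>) = (\<integral>\<^sup>+x\<in>\<Omega>. ennreal (\<rho> x) * f x \<partial>lborel)"
proof -
  have [measurable]: "\<rho> \<in> borel_measurable (restrict_space lborel \<Omega>)"
    using borel_measurable_continuous_on_restrict[OF density(1)]
    by (simp cong: measurable_cong_sets add: sets_restrict_space_cong[OF sets_lborel])
  have "f \<in> borel_measurable (restrict_space lborel \<Omega>)"
    by (rule measurable_restrict_space1) simp
  then have "(\<integral>\<^sup>+x. f x \<partial>\<mu>) = (\<integral>\<^sup>+x. ennreal (\<rho> x) * f x \<partial>restrict_space lborel \<Omega>)"
    using density(2) unfolding has_density_on_def by (auto simp: nn_integral_density)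
  also have "\<dots> = (\<integral>\<^sup>+x\<in>\<Omega>. ennreal (\<rho> x) * f x \<partial>lborel)"
    by (rule nn_integral_restrict_space) simp
  finally show ?thesis .
qed

lemma nn_integral_\<mu>_le:
  assumes [measurable]: "f \<in> borel_measurable borel"
  shows "(\<integral>\<^sup>+x. f x \<partial>\<mu>) \<le> ennreal D * (\<integral>\<^sup>+x\<in>\<Omega>. f x \<partial>lborel)"
proof -
  have "(\<integral>\<^sup>+x. f x \<partial>\<mu>) \<le> (\<integral>\<^sup>+x. ennreal D * (f x * indicator \<Omega> x) \<partial>lborel)"
    unfolding nn_integral_\<mu>[OF assms] using density_bounds
    by (intro nn_integral_mono) (auto simp: indicator_def intro!: mult_right_mono ennreal_leI)
  then show ?thesis by (simp add: nn_integral_cmult)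
qed

lemma emeasure_lborel_le:
  assumes "A \<in> sets borel" "A \<subseteq> \<Omega>"
  shows "emeasure lborel A \<le> ennreal D * emeasure \<mu> A"
proof -
  have A: "A \<in> sets \<mu>" using assms by (auto simp: sets_\<mu> sets_restrict_space_iff)
  have "emeasure lborel A = (\<integral>\<^sup>+x. indicator A x \<partial>lborel)" using assms by simp
  also have "\<dots> \<le> (\<integral>\<^sup>+x. ennreal D * (ennreal (\<rho> x) * indicator A x * indicator \<Omega> x) \<partial>lborel)"
  proof (rule nn_integral_mono)
    fix x
    have "1 \<le> ennreal D * ennreal (\<rho> x)" if "x \<in> A"
    proof -
      have "1 \<le> D * \<rho> x" using density_bounds(2)[of x] that assms density_bounds(1) by (auto simp: divide_simps mult.commute)
      then show ?thesis using density_bounds(1)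
        by (metis ennreal_1 ennreal_leI ennreal_mult' less_imp_le)
    qed
    then show "indicator A x \<le> ennreal D * (ennreal (\<rho> x) * indicator A x * indicator \<Omega> x)"
      using assms by (auto simp: indicator_def)
  qed
  also have "\<dots> = ennreal D * (\<integral>\<^sup>+x\<in>\<Omega>. ennreal (\<rho> x) * indicator A x \<partial>lborel)"
  proof (rule nn_integral_cmult)
    have "(\<lambda>x. indicator \<Omega> x *\<^sub>R \<rho> x) \<in> borel_measurable borel"
      using density(1) by (rule borel_measurable_continuous_on_indicator[OF \<Omega>_measurable])
    then have "(\<lambda>x. ennreal (indicator \<Omega> x *\<^sub>R \<rho> x) * indicator A x) \<in> borel_measurable borel"
      using assms(1) by measurable
    also have "(\<lambda>x. ennreal (indicator \<Omega> x *\<^sub>R \<rho> x) * indicator A x) = (\<lambda>x. ennreal (\<rho> x) * indicator A x * indicator \<Omega> x)"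
      by (auto simp: indicator_def)
    finally show "(\<lambda>x. ennreal (\<rho> x) * indicator A x * indicator \<Omega> x) \<in> borel_measurable lborel" by simp
  qed
  also have "(\<integral>\<^sup>+x\<in>\<Omega>. ennreal (\<rho> x) * indicator A x \<partial>lborel) = emeasure \<mu> A"
    using assms(1) A by (subst nn_integral_\<mu>[symmetric]) auto
  finally show ?thesis .
qed

text \<open>
  Since \<open>T\<close> takes finitely many values, integrals of \<open>g \<circ> T\<close> are finite sums over the fibres of \<open>T\<close>, for an
  arbitrary function \<open>g\<close>.  The fibre over \<open>a\<close> has \<open>\<mu>\<close>-mass \<open>\<nu>{a}\<close>, and the lower bound on the density
  converts this into a bound on its Lebesgue measure.
\<close>

lemma nn_integral_transport_le:
  "(\<integral>\<^sup>+x\<in>\<Omega>. g (T x) \<partial>lborel) \<le> ennreal D * (\<Sum>a\<in>V. g a * ennreal (measure \<nu> {a}))"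
proof -
  interpret \<nu>: prob_space \<nu> using prob by (simp add: borel_prob_on_def)
  have "emeasure lborel (T -` {a} \<inter> \<Omega>) \<le> ennreal D * ennreal (measure \<nu> {a})" if "a \<in> V" for a
  proof -
    have "emeasure lborel (T -` {a} \<inter> \<Omega>) \<le> ennreal D * emeasure \<mu> (T -` {a} \<inter> \<Omega>)"
      by (rule emeasure_lborel_le[OF fibre_measurable]) simp
    also have "emeasure \<mu> (T -` {a} \<inter> \<Omega>) = emeasure (distr \<mu> (restrict_space borel \<Omega>) T) {a}"
      using T(1) that V by (subst emeasure_distr)
        (auto simp: space_\<mu> sets_restrict_space_iff cong: measurable_cong_sets[OF sets_\<mu> refl])
    finally show ?thesis by (simp add: T(3) \<nu>.emeasure_eq_measure)
  qed
  then have "(\<integral>\<^sup>+x\<in>\<Omega>. g (T x) \<partial>lborel) \<le> (\<Sum>a\<in>V. g a * (ennreal D * ennreal (measure \<nu> {a})))"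
    using V T(2) fibre_measurable
    by (subst nn_integral_finite_valued[of V]) (auto intro!: sum_mono mult_left_mono)
  then show ?thesis by (simp add: sum_distrib_left mult.left_commute)
qed

definition pullback :: "('a \<Rightarrow> real) \<Rightarrow> 'a \<Rightarrow> real" where
  "pullback u x = (if x \<in> \<Omega> then u (T x) else 0)"

lemma pullback_eq_sum: "pullback u x = (\<Sum>a\<in>V. u a * indicator (T -` {a} \<inter> \<Omega>) x)"
proof (cases "x \<in> \<Omega>")
  case True
  then have "(\<Sum>a\<in>V. u a * indicator (T -` {a} \<inter> \<Omega>) x) = (\<Sum>a\<in>V. if a = T x then u a else 0)"
    by (intro sum.cong) (auto simp: indicator_def)
  also have "\<dots> = u (T x)" using True V T by (auto simp: sum.delta)
  finally show ?thesis using True by (simp add: pullback_def)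
qed (simp add: pullback_def)

lemma pullback_measurable [measurable]: "pullback u \<in> borel_measurable borel"
  unfolding pullback_eq_sum[abs_def] using fibre_measurable by measurable

lemma pullback_bounded: "\<bar>pullback u x\<bar> \<le> (\<Sum>a\<in>V. \<bar>u a\<bar>)"
proof -
  have "\<bar>pullback u x\<bar> \<le> (\<Sum>a\<in>V. \<bar>u a * indicator (T -` {a} \<inter> \<Omega>) x\<bar>)"
    unfolding pullback_eq_sum by (rule sum_abs)
  also have "\<dots> \<le> (\<Sum>a\<in>V. \<bar>u a\<bar>)" by (intro sum_mono) (auto simp: indicator_def)
  finally show ?thesis .
qed

lemma pullback_Lp_le:
  assumes "1 \<le> p"
  shows "(\<integral>\<^sup>+x. ennreal (\<bar>pullback u x\<bar> powr p) \<partial>lborel) \<le> ennreal (D * graph_Lp_norm p V \<nu> u powr p)"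
proof -
  have "(\<integral>\<^sup>+x. ennreal (\<bar>pullback u x\<bar> powr p) \<partial>lborel) = (\<integral>\<^sup>+x\<in>\<Omega>. ennreal (\<bar>u (T x)\<bar> powr p) \<partial>lborel)"
    by (intro nn_integral_cong) (auto simp: pullback_def)
  also have "\<dots> \<le> ennreal D * (\<Sum>a\<in>V. ennreal (\<bar>u a\<bar> powr p) * ennreal (measure \<nu> {a}))"
    by (rule nn_integral_transport_le)
  also have "\<dots> = ennreal (D * (\<Sum>a\<in>V. \<bar>u a\<bar> powr p * measure \<nu> {a}))"
    using density_bounds(1) by (simp add: ennreal_mult[symmetric] sum_nonneg)
  also have "(\<Sum>a\<in>V. \<bar>u a\<bar> powr p * measure \<nu> {a}) = graph_Lp_norm p V \<nu> u powr p"
    using assms by (simp add: graph_Lp_norm_def powr_powr sum_nonneg)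
  finally show ?thesis .
qed

text \<open>
  Points of \<open>\<Omega>\<close> at distance at most \<open>c \<epsilon>\<close> have images at distance at most \<open>2 c \<epsilon>\<close>, because each of the two
  moves by at most \<open>c \<epsilon> / 2\<close>; on such pairs the kernel is at least \<open>\<alpha>\<close>.
\<close>

lemma pullback_energy_le:
  assumes close: "\<And>x. x \<in> \<Omega> \<Longrightarrow> norm (T x - x) \<le> c / 2 * \<epsilon>" and \<epsilon>: "0 < \<epsilon>" and \<alpha>: "0 < \<alpha>"
    and \<eta>: "\<And>r. 0 \<le> r \<Longrightarrow> 0 \<le> \<eta> r" "\<And>r. 0 \<le> r \<Longrightarrow> r \<le> 2 * c \<Longrightarrow> \<alpha> \<le> \<eta> r"
  shows "nonlocal_energy p \<Omega> (c * \<epsilon>) (pullback u)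
    \<le> ennreal (D\<^sup>2 / \<alpha> * \<epsilon> powr (p + DIM('a)) * graph_energy \<eta> \<epsilon> p V \<nu> u)"
proof -
  let ?m = "\<lambda>a. measure \<nu> {a}"
  define G where "G a b = \<eta> (norm (a - b) / \<epsilon>) / \<alpha> * \<bar>u a - u b\<bar> powr p" for a b
  have G0: "0 \<le> G a b" for a b using \<eta>(1) \<alpha> \<epsilon> by (simp add: G_def)
  have pointwise: "\<bar>u (T x) - u (T y)\<bar> powr p \<le> G (T x) (T y)"
    if "x \<in> \<Omega>" "y \<in> \<Omega>" "dist x y \<le> c * \<epsilon>" for x y
  proof -
    have "norm (T x - T y) = norm ((T x - x) + (x - y) + (y - T y))" by simp
    also have "\<dots> \<le> norm (T x - x) + norm (x - y) + norm (y - T y)"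
      by (intro norm_triangle_le add_right_mono norm_triangle_ineq)
    also have "\<dots> \<le> 2 * c * \<epsilon>"
      using close[of x] close[of y] that by (simp add: dist_norm norm_minus_commute)
    finally have "\<alpha> \<le> \<eta> (norm (T x - T y) / \<epsilon>)"
      using \<epsilon> by (intro \<eta>(2)) (auto simp: divide_simps)
    then have "1 * \<bar>u (T x) - u (T y)\<bar> powr p \<le> G (T x) (T y)"
      unfolding G_def using \<alpha> by (intro mult_right_mono) auto
    then show ?thesis by simp
  qed
  have "nonlocal_energy p \<Omega> (c * \<epsilon>) (pullback u)
      \<le> (\<integral>\<^sup>+x\<in>\<Omega>. \<integral>\<^sup>+y\<in>\<Omega>. ennreal (G (T x) (T y)) \<partial>lborel \<partial>lborel)"
    unfolding nonlocal_energy_def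
  proof (intro nn_integral_mono)
    fix x
    have "(\<integral>\<^sup>+y\<in>\<Omega> \<inter> cball x (c * \<epsilon>). ennreal (\<bar>pullback u x - pullback u y\<bar> powr p) \<partial>lborel)
        \<le> (\<integral>\<^sup>+y\<in>\<Omega>. ennreal (G (T x) (T y)) \<partial>lborel)" if "x \<in> \<Omega>"
      using pointwise that
      by (intro nn_integral_mono) (auto simp: indicator_def pullback_def intro!: ennreal_leI)
    then show "(\<integral>\<^sup>+y\<in>\<Omega> \<inter> cball x (c * \<epsilon>). ennreal (\<bar>pullback u x - pullback u y\<bar> powr p) \<partial>lborel) * indicator \<Omega> x
        \<le> (\<integral>\<^sup>+y\<in>\<Omega>. ennreal (G (T x) (T y)) \<partial>lborel) * indicator \<Omega> x"
      by (auto simp: indicator_def)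
  qed
  also have "\<dots> \<le> (\<integral>\<^sup>+x\<in>\<Omega>. ennreal D * (\<Sum>b\<in>V. ennreal (G (T x) b) * ennreal (?m b)) \<partial>lborel)"
    by (intro nn_integral_mono mult_right_mono nn_integral_transport_le) auto
  also have "\<dots> \<le> ennreal D * (\<Sum>a\<in>V. ennreal D * (\<Sum>b\<in>V. ennreal (G a b) * ennreal (?m b)) * ennreal (?m a))"
    by (rule nn_integral_transport_le)
  also have "\<dots> = ennreal (D * (\<Sum>a\<in>V. D * (\<Sum>b\<in>V. G a b * ?m b) * ?m a))"
    using density_bounds(1) G0
    by (simp add: ennreal_mult[symmetric] sum_nonneg)
  also have "D * (\<Sum>a\<in>V. D * (\<Sum>b\<in>V. G a b * ?m b) * ?m a)
      = D\<^sup>2 / \<alpha> * (\<Sum>a\<in>V. \<Sum>b\<in>V. \<eta> (norm (a - b) / \<epsilon>) * \<bar>u a - u b\<bar> powr p * ?m a * ?m b)"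
    unfolding G_def by (simp add: sum_distrib_left sum_distrib_right power2_eq_square mult_ac)
  also have "(\<Sum>a\<in>V. \<Sum>b\<in>V. \<eta> (norm (a - b) / \<epsilon>) * \<bar>u a - u b\<bar> powr p * ?m a * ?m b)
      = \<epsilon> powr (p + DIM('a)) * graph_energy \<eta> \<epsilon> p V \<nu> u"
    using \<epsilon> by (simp add: graph_energy_def scaled_kernel_def powr_add powr_realpow sum_distrib_left)
  finally show ?thesis by (simp add: mult_ac)
qed

lemma integrable_bounded_borel:
  assumes "borel_prob_on \<Omega> \<kappa>" "g \<in> borel_measurable \<kappa>" "\<And>x. x \<in> \<Omega> \<Longrightarrow> \<bar>g x\<bar> \<le> b"
  shows "integrable \<kappa> (g :: 'a \<Rightarrow> real)"
proof -
  interpret prob_space \<kappa> using assms(1) by (simp add: borel_prob_on_def)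
  have "sets \<kappa> = sets (restrict_space borel \<Omega>)" using assms(1) by (simp add: borel_prob_on_def)
  from sets_eq_imp_space_eq[OF this] have "space \<kappa> = \<Omega>" by (simp add: space_restrict_space)
  then show ?thesis
    using assms by (intro integrable_const_bound[of _ b]) auto
qed

lemma borel_measurable_prob_on:
  assumes "borel_prob_on \<Omega> \<kappa>" "g \<in> borel_measurable borel"
  shows "g \<in> borel_measurable \<kappa>"
proof -
  have "sets \<kappa> = sets (restrict_space borel \<Omega>)" using assms(1) by (simp add: borel_prob_on_def)
  from measurable_cong_sets[OF this refl] show ?thesis
    using measurable_restrict_space1[OF assms(2)] by auto
qed

lemma integrable_norm_powr:
  assumes "borel_prob_on \<Omega> \<kappa>" "0 \<le> p"
  shows "integrable \<kappa> (\<lambda>x. norm x powr p)"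
proof -
  obtain b where b: "\<And>x. x \<in> \<Omega> \<Longrightarrow> norm x \<le> b" using bounded_\<Omega> by (auto simp: bounded_iff)
  show ?thesis
    by (rule integrable_bounded_borel[OF assms(1) borel_measurable_prob_on[OF assms(1)], of _ "b powr p"])
       (use b assms(2) in \<open>auto intro!: powr_mono2\<close>)
qed

lemma zero_extension_measurable: "zero_extension V u \<in> borel_measurable borel"
proof -
  have "zero_extension V u = (\<lambda>x. \<Sum>a\<in>V. u a * indicator {a} x)"
  proof
    fix x
    have "(\<Sum>a\<in>V. u a * indicator {a} x) = (\<Sum>a\<in>V. if a = x then u a else 0)"
      by (intro sum.cong) (auto simp: indicator_def)
    also have "\<dots> = zero_extension V u x" using V(1) by (simp add: zero_extension_def sum.delta)
    finally show "zero_extension V u x = (\<Sum>a\<in>V. u a * indicator {a} x)" by simp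
  qed
  then show ?thesis by simp
qed

lemma zero_extension_in_TLp:
  assumes "0 \<le> p"
  shows "(zero_extension V u, \<nu>) \<in> TLp p \<Omega>"
proof -
  have b: "\<bar>zero_extension V u x\<bar> \<le> (\<Sum>a\<in>V. \<bar>u a\<bar>)" for x
    using V(1) by (auto simp: zero_extension_def intro!: member_le_sum sum_nonneg)
  have m: "zero_extension V u \<in> borel_measurable \<nu>"
    by (rule borel_measurable_prob_on[OF prob(2) zero_extension_measurable])
  have "integrable \<nu> (\<lambda>x. \<bar>zero_extension V u x\<bar> powr p)"
    by (rule integrable_bounded_borel[OF prob(2), of _ "(\<Sum>a\<in>V. \<bar>u a\<bar>) powr p"])
       (use m b assms in \<open>auto intro!: powr_mono2\<close>)
  then show ?thesis
    using m prob(2) integrable_norm_powr[OF prob(2) assms] by (simp add: TLp_def)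
qed

lemma Lp_limit_in_TLp:
  assumes p: "1 \<le> p" and [measurable]: "f \<in> borel_measurable borel"
    and fin: "(\<integral>\<^sup>+x\<in>\<Omega>. ennreal (\<bar>pullback u x - f x\<bar> powr p) \<partial>lborel) < \<infinity>"
  shows "(f, \<mu>) \<in> TLp p \<Omega>"
proof -
  let ?w = "pullback u"
  have f: "f \<in> borel_measurable \<mu>" by (rule borel_measurable_prob_on[OF prob(1)]) simp
  have "integrable \<mu> (\<lambda>x. \<bar>?w x\<bar> powr p)"
    by (rule integrable_bounded_borel[OF prob(1) borel_measurable_prob_on[OF prob(1)],
          of _ "(\<Sum>a\<in>V. \<bar>u a\<bar>) powr p"])
       (use pullback_bounded p in \<open>auto intro!: powr_mono2\<close>)
  moreover have "integrable \<mu> (\<lambda>x. \<bar>?w x - f x\<bar> powr p)"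
  proof (rule integrableI_bounded)
    have "(\<integral>\<^sup>+x. ennreal (norm (\<bar>?w x - f x\<bar> powr p)) \<partial>\<mu>)
        \<le> ennreal D * (\<integral>\<^sup>+x\<in>\<Omega>. ennreal (\<bar>?w x - f x\<bar> powr p) \<partial>lborel)"
      using nn_integral_\<mu>_le[of "\<lambda>x. ennreal (\<bar>?w x - f x\<bar> powr p)"] by simp
    also have "\<dots> < \<infinity>" using fin by (simp add: ennreal_mult_less_top)
    finally show "(\<integral>\<^sup>+x. ennreal (norm (\<bar>?w x - f x\<bar> powr p)) \<partial>\<mu>) < \<infinity>" .
  qed (rule borel_measurable_prob_on[OF prob(1)], simp)
  ultimately have "integrable \<mu> (\<lambda>x. 2 powr (p - 1) * (\<bar>?w x\<bar> powr p + \<bar>?w x - f x\<bar> powr p))"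
    by simp
  then have "integrable \<mu> (\<lambda>x. \<bar>f x\<bar> powr p)"
  proof (rule Bochner_Integration.integrable_bound)
    show "(\<lambda>x. \<bar>f x\<bar> powr p) \<in> borel_measurable \<mu>" using f by simp
    show "AE x in \<mu>. norm (\<bar>f x\<bar> powr p) \<le> norm (2 powr (p - 1) * (\<bar>?w x\<bar> powr p + \<bar>?w x - f x\<bar> powr p))"
    proof (rule AE_I2)
      fix x
      show "norm (\<bar>f x\<bar> powr p) \<le> norm (2 powr (p - 1) * (\<bar>?w x\<bar> powr p + \<bar>?w x - f x\<bar> powr p))"
        using abs_add_powr_le[OF p, of "?w x" "f x - ?w x"] by (simp add: abs_minus_commute)
    qed
  qed
  then show ?thesis
    using f prob(1) integrable_norm_powr[OF prob(1), of p] p by (simp add: TLp_def)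
qed

lemma TLp_dist_bounds:
  assumes p: "1 \<le> p" and [measurable]: "f \<in> borel_measurable borel"
    and close: "\<And>x. x \<in> \<Omega> \<Longrightarrow> norm (T x - x) \<le> \<delta>"
    and error: "(\<integral>\<^sup>+x\<in>\<Omega>. ennreal (\<bar>pullback u x - f x\<bar> powr p) \<partial>lborel) \<le> ennreal e" and e: "0 \<le> e"
  shows "0 \<le> TLp_dist p (zero_extension V u, \<nu>) (f, \<mu>)"
    and "TLp_dist p (zero_extension V u, \<nu>) (f, \<mu>) \<le> (\<delta> powr p + D * e) powr (1 / p)"
proof -
  interpret \<mu>: prob_space \<mu> using prob(1) by (simp add: borel_prob_on_def)
  let ?\<phi> = "zero_extension V u"
  have \<phi>: "?\<phi> \<in> borel_measurable \<nu>" and f: "f \<in> borel_measurable \<mu>"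
    by (rule borel_measurable_prob_on[OF prob(2) zero_extension_measurable],
        rule borel_measurable_prob_on[OF prob(1) assms(2)])
  note dist = TLp_dist_le_transport_map[OF prob(1) prob(2) T(1) T(3) \<phi> f, of p]
  show "0 \<le> TLp_dist p (?\<phi>, \<nu>) (f, \<mu>)" by (rule dist(1))
  let ?h = "\<lambda>x. norm (T x - x) powr p + \<bar>?\<phi> (T x) - f x\<bar> powr p"
  have "(\<integral>x. ?h x \<partial>\<mu>) \<le> \<delta> powr p + D * e"
  proof (rule integral_real_bounded)
    have "(\<integral>\<^sup>+x. ennreal (?h x) \<partial>\<mu>)
        \<le> (\<integral>\<^sup>+x. ennreal (\<delta> powr p) + ennreal (\<bar>pullback u x - f x\<bar> powr p) \<partial>\<mu>)"
    proof (rule nn_integral_mono)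
      fix x
      assume "x \<in> space \<mu>"
      then have x: "x \<in> \<Omega>" by (simp add: space_\<mu>)
      then have "?\<phi> (T x) = pullback u x" using T(2) by (auto simp: zero_extension_def pullback_def)
      moreover have "norm (T x - x) powr p \<le> \<delta> powr p"
        using close[OF x] p by (intro powr_mono2) auto
      ultimately show "ennreal (?h x) \<le> ennreal (\<delta> powr p) + ennreal (\<bar>pullback u x - f x\<bar> powr p)"
        by (simp add: ennreal_leI add_right_mono flip: ennreal_plus)
    qed
    also have "\<dots> = ennreal (\<delta> powr p) + (\<integral>\<^sup>+x. ennreal (\<bar>pullback u x - f x\<bar> powr p) \<partial>\<mu>)"
    proof (subst nn_integral_add)
      show "(\<lambda>x. ennreal (\<bar>pullback u x - f x\<bar> powr p)) \<in> borel_measurable \<mu>"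
        using borel_measurable_prob_on[OF prob(1), of "\<lambda>x. \<bar>pullback u x - f x\<bar> powr p"] by simp
    qed (simp_all add: \<mu>.emeasure_space_1)
    also have "\<dots> \<le> ennreal (\<delta> powr p) + ennreal D * ennreal e"
      using nn_integral_\<mu>_le[of "\<lambda>x. ennreal (\<bar>pullback u x - f x\<bar> powr p)"] error
      by (intro add_left_mono) (auto elim: order_trans intro!: mult_left_mono)
    also have "\<dots> = ennreal (\<delta> powr p + D * e)"
      using density_bounds(1) e by (simp add: ennreal_mult)
    finally show "(\<integral>\<^sup>+x. ennreal (?h x) \<partial>\<mu>) \<le> ennreal (\<delta> powr p + D * e)" .
  qed (use density_bounds(1) e in auto)
  moreover have "0 \<le> (\<integral>x. ?h x \<partial>\<mu>)" by (intro integral_nonneg_AE AE_I2) auto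
  ultimately have "(\<integral>x. ?h x \<partial>\<mu>) powr (1 / p) \<le> (\<delta> powr p + D * e) powr (1 / p)"
    using p by (intro powr_mono2) auto
  with dist(2) show "TLp_dist p (?\<phi>, \<nu>) (f, \<mu>) \<le> (\<delta> powr p + D * e) powr (1 / p)"
    by (rule order_trans)
qed

end

section \<open>Relative compactness in \<open>TL\<^sup>p\<close>\<close>

lemma kernel_lower_bound_near_0:
  assumes "continuous (at 0 within {0..}) \<eta>" "0 < \<eta> (0::real)"
  obtains c where "0 < c" "\<And>r. 0 \<le> r \<Longrightarrow> r \<le> 2 * c \<Longrightarrow> \<eta> 0 / 2 \<le> (\<eta> r :: real)"
proof -
  from assms obtain d where d: "0 < d" "\<And>r. r \<in> {0..} \<Longrightarrow> dist r 0 < d \<Longrightarrow> dist (\<eta> r) (\<eta> 0) < \<eta> 0 / 2"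
    unfolding continuous_within_eps_delta by (meson half_gt_zero)
  show ?thesis
  proof (rule that[of "d / 4"])
    fix r :: real
    assume "0 \<le> r" "r \<le> 2 * (d / 4)"
    then have "dist (\<eta> r) (\<eta> 0) < \<eta> 0 / 2" using d(1) by (intro d(2)) (auto simp: dist_real_def)
    then show "\<eta> 0 / 2 \<le> \<eta> r" unfolding dist_real_def by linarith
  qed (use d in simp)
qed

text \<open>
  The functions \<open>u\<^sub>n \<circ> T\<^sub>n\<close> satisfy the energy bound at scale \<open>c \<epsilon>\<^sub>n\<close>, so along a subsequence they converge in
  \<open>L\<^sup>p(\<Omega>)\<close>; by \<open>TLp_dist_bounds\<close> the pairs \<open>(u\<^sub>n, \<mu>\<^sub>n)\<close> then converge in \<open>TL\<^sup>p\<close>.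
\<close>

lemma TLp_relatively_compact_of_bounded_energy:
  fixes \<Omega> :: "'a::euclidean_space set"
  assumes p: "1 \<le> p" and \<Omega>: "open \<Omega>" "bounded \<Omega>" "lipschitz_boundary \<Omega>"
    and disc: "\<And>n. discretised_domain \<Omega> \<mu> \<rho> (V n) (\<mu>n n) (T n) D"
    and \<epsilon>: "\<And>n. 0 < \<epsilon> n" "\<epsilon> \<longlonglongrightarrow> 0"
    and close: "\<And>n x. x \<in> \<Omega> \<Longrightarrow> norm (T n x - x) \<le> c / 2 * \<epsilon> n"
    and c: "0 < c" and \<alpha>: "0 < \<alpha>"
    and \<eta>: "\<And>r. 0 \<le> r \<Longrightarrow> 0 \<le> \<eta> r" "\<And>r. 0 \<le> r \<Longrightarrow> r \<le> 2 * c \<Longrightarrow> \<alpha> \<le> \<eta> r"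
    and norm_bdd: "bounded (range (\<lambda>n. graph_Lp_norm p (V n) (\<mu>n n) (u n)))"
    and energy_bdd: "bounded (range (\<lambda>n. graph_energy \<eta> (\<epsilon> n) p (V n) (\<mu>n n) (u n)))"
  shows "TLp_relatively_compact p \<Omega> (\<lambda>n. (zero_extension (V n) (u n), \<mu>n n))"
proof -
  interpret X: discretised_domain \<Omega> \<mu> \<rho> "V n" "\<mu>n n" "T n" D for n by (rule disc)
  have D: "0 < D" by (rule X.density_bounds(1))
  obtain B where B: "\<And>n. graph_Lp_norm p (V n) (\<mu>n n) (u n) \<le> B"
    using norm_bdd by (auto simp: bounded_iff abs_le_iff)
  obtain B' where B': "\<And>n. graph_energy \<eta> (\<epsilon> n) p (V n) (\<mu>n n) (u n) \<le> B'"
    using energy_bdd by (auto simp: bounded_iff abs_le_iff)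
  define w where "w n = X.pullback n (u n)" for n
  \<comment> \<open>Division by \<open>c\<^sup>p\<^sup>+\<^sup>d\<close> expresses the bound in terms of the scale \<open>c \<epsilon>\<^sub>n\<close>.\<close>
  define M where "M = D\<^sup>2 / \<alpha> * \<bar>B'\<bar> / c powr (p + DIM('a))"
  have norm_bound: "(\<integral>\<^sup>+x. ennreal (\<bar>w n x\<bar> powr p) \<partial>lborel) \<le> ennreal (D * B powr p)" for n
  proof -
    have "graph_Lp_norm p (V n) (\<mu>n n) (u n) powr p \<le> B powr p"
      using B[of n] p by (intro powr_mono2) (auto simp: graph_Lp_norm_def)
    then show ?thesis
      unfolding w_def using D
      by (intro order_trans[OF X.pullback_Lp_le[OF p]] ennreal_leI mult_left_mono) auto
  qed
  have energy_bound: "nonlocal_energy p \<Omega> (c * \<epsilon> n) (w n) \<le> ennreal (M * (c * \<epsilon> n) powr (p + DIM('a)))" for n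
  proof -
    have "D\<^sup>2 / \<alpha> * \<epsilon> n powr (p + DIM('a)) * graph_energy \<eta> (\<epsilon> n) p (V n) (\<mu>n n) (u n)
        \<le> D\<^sup>2 / \<alpha> * \<epsilon> n powr (p + DIM('a)) * \<bar>B'\<bar>"
      using B'[of n] \<alpha> by (intro mult_left_mono) auto
    also have "\<dots> = M * (c * \<epsilon> n) powr (p + DIM('a))"
      using c \<epsilon>(1)[of n] by (simp add: M_def powr_mult)
    finally show ?thesis
      unfolding w_def
      by (intro order_trans[OF X.pullback_energy_le[OF close \<epsilon>(1) \<alpha> \<eta>]] ennreal_leI) auto
  qed
  show ?thesis
    unfolding TLp_relatively_compact_def
  proof (intro conjI allI impI)
    show "(zero_extension (V n) (u n), \<mu>n n) \<in> TLp p \<Omega>" for n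
      using p by (intro X.zero_extension_in_TLp) simp
    fix r :: "nat \<Rightarrow> nat"
    assume r: "strict_mono r"
    interpret Y: nonlocal_energy_bounded p \<Omega> "\<lambda>n. c * \<epsilon> (r n)" "\<lambda>n. w (r n)" "D * B powr p" M
    proof
      show "1 \<le> p" "open \<Omega>" "bounded \<Omega>" by fact+
      show "interior_cone_at \<Omega> x" if "x \<in> closure \<Omega>" for x
        using \<Omega> that by (intro lipschitz_boundary_interior_cone)
      show "w (r n) \<in> borel_measurable borel" for n
        unfolding w_def by (rule X.pullback_measurable)
      show "\<exists>b. \<forall>x. \<bar>w (r n) x\<bar> \<le> b" for n
        unfolding w_def using X.pullback_bounded by blast
      show "w (r n) x = 0" if "x \<notin> \<Omega>" for n x
        using that by (simp add: w_def X.pullback_def)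
      show "0 \<le> D * B powr p" using D by simp
      show "0 \<le> M" using D \<alpha> by (simp add: M_def)
      show "0 < c * \<epsilon> (r n)" for n using c \<epsilon>(1) by simp
      have "(\<lambda>n. \<epsilon> (r n)) \<longlonglongrightarrow> 0" using LIMSEQ_subseq_LIMSEQ[OF \<epsilon>(2) r] by (simp add: o_def)
      then show "(\<lambda>n. c * \<epsilon> (r n)) \<longlonglongrightarrow> 0" by (rule tendsto_mult_right_zero)
    qed (rule norm_bound energy_bound)+
    obtain s f where s: "strict_mono s" and f [measurable]: "f \<in> borel_measurable borel"
      and lim: "(\<lambda>n. \<integral>\<^sup>+x\<in>\<Omega>. ennreal (\<bar>w (r (s n)) x - f x\<bar> powr p) \<partial>lborel) \<longlonglongrightarrow> 0"
      using Y.Lp_convergent_subsequence by blast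
    define E where "E n = (\<integral>\<^sup>+x\<in>\<Omega>. ennreal (\<bar>w (r (s n)) x - f x\<bar> powr p) \<partial>lborel)" for n
    have E_fin: "eventually (\<lambda>n. E n < \<infinity>) sequentially"
      using order_tendstoD(2)[OF lim, of \<infinity>] unfolding E_def by simp
    then obtain n0 where "E n0 < \<infinity>" by (auto simp: eventually_sequentially)
    then have Z: "(f, \<mu>) \<in> TLp p \<Omega>"
      unfolding E_def w_def by (rule X.Lp_limit_in_TLp[OF p f])
    define b where "b n = ((c / 2 * \<epsilon> (r (s n))) powr p + D * enn2real (E n)) powr (1 / p)" for n
    have bounds: "eventually (\<lambda>n. 0 \<le> TLp_dist p (zero_extension (V (r (s n))) (u (r (s n))), \<mu>n (r (s n))) (f, \<mu>) \<and>
        TLp_dist p (zero_extension (V (r (s n))) (u (r (s n))), \<mu>n (r (s n))) (f, \<mu>) \<le> b n) sequentially"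
      using E_fin
    proof eventually_elim
      case (elim n)
      then have "(\<integral>\<^sup>+x\<in>\<Omega>. ennreal (\<bar>X.pullback (r (s n)) (u (r (s n))) x - f x\<bar> powr p) \<partial>lborel) \<le> ennreal (enn2real (E n))"
        by (simp add: E_def w_def)
      from X.TLp_dist_bounds[OF p f close this] show ?case by (simp add: b_def)
    qed
    have "(\<lambda>n. enn2real (E n)) \<longlonglongrightarrow> 0"
      by (rule tendsto_enn2real) (use lim in \<open>simp_all add: E_def\<close>)
    moreover have "(\<lambda>n. (c / 2 * \<epsilon> (r (s n))) powr p) \<longlonglongrightarrow> 0"
    proof (rule tendsto_zero_powrI[OF _ tendsto_const])
      have "strict_mono (r \<circ> s)" using r s by (rule strict_mono_o)
      then have "(\<lambda>n. \<epsilon> (r (s n))) \<longlonglongrightarrow> 0" using LIMSEQ_subseq_LIMSEQ[OF \<epsilon>(2)] by (auto simp: o_def)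
      then show "(\<lambda>n. c / 2 * \<epsilon> (r (s n))) \<longlonglongrightarrow> 0" by (rule tendsto_mult_right_zero)
    qed (use p c \<epsilon>(1) in \<open>auto simp: less_imp_le\<close>)
    ultimately have "(\<lambda>n. (c / 2 * \<epsilon> (r (s n))) powr p + D * enn2real (E n)) \<longlonglongrightarrow> 0"
      using tendsto_add[OF _ tendsto_mult_right_zero] by fastforce
    then have "b \<longlonglongrightarrow> 0"
      unfolding b_def
      by (rule tendsto_zero_powrI[OF _ tendsto_const]) (use p D in auto)
    then have "(\<lambda>n. TLp_dist p (zero_extension (V (r (s n))) (u (r (s n))), \<mu>n (r (s n))) (f, \<mu>)) \<longlonglongrightarrow> 0"
      by (rule tendsto_sandwich[OF _ _ tendsto_const, rotated 2]) (use bounds in \<open>auto elim: eventually_mono\<close>)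
    with s Z show "\<exists>s. strict_mono s \<and> (\<exists>Z\<in>TLp p \<Omega>.
        (\<lambda>k. TLp_dist p (zero_extension (V (r (s k))) (u (r (s k))), \<mu>n (r (s k))) Z) \<longlonglongrightarrow> 0)"
      by (intro exI[of _ s] conjI bexI[of _ "(f, \<mu>)"])
  qed
qed

theorem proposition5p5:
  fixes \<eta> :: "real \<Rightarrow> real"
  assumes "\<forall>r\<ge>0. 0 \<le> \<eta> r"
  shows "\<exists>H>0. \<forall>(p::real) (\<Omega>::'a::euclidean_space set) \<mu> \<rho> V \<mu>n \<epsilon> (u::nat \<Rightarrow> 'a \<Rightarrow> real).
    1 \<le> p \<and>
    open \<Omega> \<and> bounded \<Omega> \<and> lipschitz_boundary \<Omega> \<and>
    borel_prob_on \<Omega> \<mu> \<and> continuous_on \<Omega> \<rho> \<and> has_density_on \<Omega> \<mu> \<rho> \<and>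
    (\<forall>n::nat. finite (V n) \<and> V n \<subseteq> \<Omega>) \<and>
    (\<forall>n. borel_prob_on \<Omega> (\<mu>n n) \<and> measure (\<mu>n n) (V n) = 1) \<and>
    (\<forall>n. 0 < \<epsilon> n) \<and> \<epsilon> \<longlonglongrightarrow> 0 \<and>
    (\<exists>K>0. K \<le> H \<and> (\<exists>T :: nat \<Rightarrow> 'a \<Rightarrow> 'a. \<forall>n.
        T n \<in> restrict_space borel \<Omega> \<rightarrow>\<^sub>M restrict_space borel \<Omega> \<and> T n ` \<Omega> \<subseteq> V n \<and>
        distr \<mu> (restrict_space borel \<Omega>) (T n) = \<mu>n n \<and>
        (\<forall>x\<in>\<Omega>. norm (T n x - x) \<le> K * \<epsilon> n))) \<and>
    continuous (at 0 within {0..}) \<eta> \<and> antimono_on {0..} \<eta> \<and> 0 < \<eta> 0 \<and>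
    (\<exists>D>0. \<forall>x\<in>\<Omega>. 1 / D \<le> \<rho> x \<and> \<rho> x \<le> D) \<and>
    (\<exists>q>p. kernel_moment DIM('a) \<eta> q < \<infinity>) \<and>
    bounded (range (\<lambda>n. graph_Lp_norm p (V n) (\<mu>n n) (u n))) \<and>
    bounded (range (\<lambda>n. graph_energy \<eta> (\<epsilon> n) p (V n) (\<mu>n n) (u n)))
    \<longrightarrow> TLp_relatively_compact p \<Omega> (\<lambda>n. (zero_extension (V n) (u n), \<mu>n n))"
proof (cases "continuous (at 0 within {0..}) \<eta> \<and> 0 < \<eta> 0")
  case False
  \<comment> \<open>The conditions on \<open>\<eta>\<close> fail, and every \<open>H\<close> is admissible.\<close>
  then show ?thesis by (intro exI[of _ 1] conjI) auto
next
  case True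
  then obtain c where c: "0 < c" and lower: "\<And>r. 0 \<le> r \<Longrightarrow> r \<le> 2 * c \<Longrightarrow> \<eta> 0 / 2 \<le> \<eta> r"
    using kernel_lower_bound_near_0 by blast
  show ?thesis
  proof (rule exI[of _ "c / 2"], intro conjI allI impI, goal_cases)
    case (2 p \<Omega> \<mu> \<rho> V \<mu>n \<epsilon> u)
    then show ?case
    proof (elim conjE exE, goal_cases)
      case (1 K D q T)
      note K = \<open>K \<le> c / 2\<close> and T = \<open>\<forall>n. T n \<in> _ \<and> _\<close> and D = \<open>\<forall>x\<in>\<Omega>. 1 / D \<le> \<rho> x \<and> \<rho> x \<le> D\<close>
      have "discretised_domain \<Omega> \<mu> \<rho> (V n) (\<mu>n n) (T n) D" for n
        using 1 T[rule_format, of n] D by unfold_locales auto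
      moreover have "norm (T n x - x) \<le> c / 2 * \<epsilon> n" if "x \<in> \<Omega>" for n x
      proof -
        have "norm (T n x - x) \<le> K * \<epsilon> n" using T that by blast
        also have "\<dots> \<le> c / 2 * \<epsilon> n"
          using K \<open>\<forall>n. 0 < \<epsilon> n\<close> by (intro mult_right_mono) (auto intro: less_imp_le)
        finally show ?thesis .
      qed
      ultimately show ?case
        using 1 c assms lower
        by (intro TLp_relatively_compact_of_bounded_energy[where c = c and \<alpha> = "\<eta> 0 / 2" and \<eta> = \<eta> and \<epsilon> = \<epsilon> and T = T]) simp_all
    qed
  qed (use c in simp)
qed

end
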